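(* Let $N\ge1$, consider the differential calculus of the fuzzy sphere spectral triple described in the context with $\mathcal{E}=\Omega^1(A_N)$ free with basis $e_k=1\otimes\sigma_k$ ($k=1,2,3$), and let $g$ be the canonical pseudo-Riemannian bilinear metric, i.e. the right $A_N$-linear extension of $g(e_k\otimes_{A_N}e_j)=\delta_{kj}$. Let $\nabla$ be the unique connection on $\mathcal{E}$ which is torsionless and compatible with $g$ on $\mathcal{Z}(\mathcal{E})$, and write $\nabla(e_k)=\sum_je_j\otimes_{A_N}\omega_{jk}$ with $\omega_{jk}\in\mathcal{E}$. Then $$\omega_{jk}=-\tfrac12\sum_{l}\epsilon_{jkl}\,e_l.$$
   Context: Fuzzy sphere spectral triple: $J_1,J_2,J_3$ basis of $su(2)$ with $[J_k,J_l]=\sum_m\epsilon_{klm}J_m$ ($\epsilon_{123}=1$); $\rho_{n/2}$ the $(n+1)$-dimensional irreducible unitary representation; $K_N=\oplus_{n=0}^N\mathbb{C}^{n+1}$, $X_k=\oplus_{n=0}^N\rho_{n/2}(J_k)$, $A_N=B(K_N)$, $H_N=K_N\otimes\mathbb{C}^2$ with $a\mapsto a\otimes1$, $\sigma_k=\sqrt{-1}\tau_k$ ($\tau_k$ Pauli matrices), $D_N=\sum_kX_k\otimes\sigma_k$. Differential calculus: $\Omega^1(A_N)=\{\sum a_j[D_N,b_j]\}$, $da=[D_N,a]$; $\Omega^2(A_N)=\mathcal{S}/J^2$ with $\mathcal{S}$ the span of $a_0[D_N,a_1][D_N,a_2]$ and $J^2=\{\sum_j[D_N,a_j][D_N,b_j]:\sum_ja_j[D_N,b_j]=0\}$;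 $\wedge$ is multiplication followed by the quotient; $d(\sum a_j[D_N,b_j])=[\sum_j[D_N,a_j][D_N,b_j]]$. The splitting used is $\mathcal{E}\otimes\mathcal{E}=\ker\wedge\oplus\mathcal{F}$ with $\mathcal{F}$ the antisymmetric tensors $\{\sum a_{kj}e_k\otimes e_j: a_{kj}=-a_{jk}\}$, and $\sigma=2P_{\rm sym}-1$ with $P_{\rm sym}$ the idempotent with image $\ker\wedge$ and kernel $\mathcal{F}$ (so $\sigma$ flips $e_k\otimes e_j$). A connection is a $\mathbb{C}$-linear $\nabla:\mathcal{E}\to\mathcal{E}\otimes_{A_N}\mathcal{E}$ with $\nabla(\omega a)=\nabla(\omega)a+\omega\otimes da$; torsionless means $\wedge\circ\nabla+d=0$; compatible with $g$ on $\mathcal{Z}(\mathcal{E})$ means $(g\otimes\mathrm{id})\{\sigma_{23}(\nabla(\omega)\otimes\eta)+\omega\otimes\nabla(\eta)\}=d(g(\omega\otimes\eta))$ for all central $\omega,\eta$, with $\sigma_{23}=\mathrm{id}\otimes\sigma$ and $(g\otimes\mathrm{id})(x\otimes y\otimes z)=g(x\otimes y)z$. *)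

theory Defs
  imports Complex_Main "Jordan_Normal_Form.Matrix"
begin

datatype ix = i1 | i2 | i3

lemma UNIV_ix: "(UNIV :: ix set) = {i1, i2, i3}"
  using ix.exhaust by auto

instance ix :: finite
  by standard (simp add: UNIV_ix)

definition sum3 :: "(ix \<Rightarrow> 'a :: plus) \<Rightarrow> 'a" where
  "sum3 f = f i1 + f i2 + f i3"

definition lc :: "ix \<Rightarrow> ix \<Rightarrow> ix \<Rightarrow> complex" where
  "lc k l m =
     (if (k, l, m) \<in> {(i1, i2, i3), (i2, i3, i1), (i3, i1, i2)} then 1
      else if (k, l, m) \<in> {(i2, i1, i3), (i3, i2, i1), (i1, i3, i2)} then -1
      else 0)"

definition adj :: "complex mat \<Rightarrow> complex mat" where
  "adj A = mat (dim_col A) (dim_row A) (\<lambda>(i, j). cnj (A $$ (j, i)))"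

definition comm :: "complex mat \<Rightarrow> complex mat \<Rightarrow> complex mat" where
  "comm A B = A * B - B * A"

definition kron :: "complex mat \<Rightarrow> complex mat \<Rightarrow> complex mat" where
  "kron A B = mat (dim_row A * dim_row B) (dim_col A * dim_col B)
     (\<lambda>(i, j). A $$ (i div dim_row B, j div dim_col B) * B $$ (i mod dim_row B, j mod dim_col B))"

definition dsum :: "complex mat \<Rightarrow> complex mat \<Rightarrow> complex mat" where
  "dsum A B = four_block_mat A (0\<^sub>m (dim_row A) (dim_col B)) (0\<^sub>m (dim_row B) (dim_col A)) B"

definition msum :: "nat \<Rightarrow> complex mat list \<Rightarrow> complex mat" where
  "msum d xs = foldr (+) xs (0\<^sub>m d d)"

definition tau :: "ix \<Rightarrow> complex mat" where
  "tau k = (case k of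
      i1 \<Rightarrow> mat_of_rows_list 2 [[0, 1], [1, 0]]
    | i2 \<Rightarrow> mat_of_rows_list 2 [[0, -\<i>], [\<i>, 0]]
    | i3 \<Rightarrow> mat_of_rows_list 2 [[1, 0], [0, -1]])"

definition sig :: "ix \<Rightarrow> complex mat" where
  "sig k = \<i> \<cdot>\<^sub>m tau k"

definition su2_unitary_rep :: "nat \<Rightarrow> (ix \<Rightarrow> complex mat) \<Rightarrow> bool" where
  "su2_unitary_rep d \<rho> \<longleftrightarrow>
     (\<forall>k. \<rho> k \<in> carrier_mat d d) \<and>
     (\<forall>k. adj (\<rho> k) = - \<rho> k) \<and>
     (\<forall>k l. comm (\<rho> k) (\<rho> l) = sum3 (\<lambda>m. lc k l m \<cdot>\<^sub>m \<rho> m))"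

definition irreducible_rep :: "nat \<Rightarrow> (ix \<Rightarrow> complex mat) \<Rightarrow> bool" where
  "irreducible_rep d \<rho> \<longleftrightarrow>
     (\<forall>W. W \<subseteq> carrier_vec d \<and> 0\<^sub>v d \<in> W \<and> (\<forall>u\<in>W. \<forall>v\<in>W. u + v \<in> W) \<and>
          (\<forall>c. \<forall>u\<in>W. c \<cdot>\<^sub>v u \<in> W) \<and> (\<forall>k. \<forall>u\<in>W. \<rho> k *\<^sub>v u \<in> W)
        \<longrightarrow> W = {0\<^sub>v d} \<or> W = carrier_vec d)"

definition su2_irreps :: "nat \<Rightarrow> (nat \<Rightarrow> ix \<Rightarrow> complex mat) \<Rightarrow> bool" where
  "su2_irreps N R \<longleftrightarrow>
     (\<forall>n\<le>N. su2_unitary_rep (n + 1) (R n) \<and> irreducible_rep (n + 1) (R n))"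

definition Kdim :: "nat \<Rightarrow> nat" where
  "Kdim N = (\<Sum>n\<le>N. n + 1)"

fun Xop :: "(nat \<Rightarrow> ix \<Rightarrow> complex mat) \<Rightarrow> nat \<Rightarrow> ix \<Rightarrow> complex mat" where
  "Xop R 0 k = R 0 k"
| "Xop R (Suc n) k = dsum (Xop R n k) (R (Suc n) k)"

definition Dop :: "nat \<Rightarrow> (nat \<Rightarrow> ix \<Rightarrow> complex mat) \<Rightarrow> complex mat" where
  "Dop N R = sum3 (\<lambda>k. kron (Xop R N k) (sig k))"

text \<open>The algebra A_N = B(K_N) and its representation a \<mapsto> a \<otimes> 1 on H_N = K_N \<otimes> C^2.\<close>
definition Aalg :: "nat \<Rightarrow> complex mat set" where
  "Aalg N = carrier_mat (Kdim N) (Kdim N)"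

definition Lm :: "complex mat \<Rightarrow> complex mat" where
  "Lm a = kron a (1\<^sub>m 2)"

definition Hdim :: "nat \<Rightarrow> nat" where
  "Hdim N = 2 * Kdim N"

definition Omega1 :: "nat \<Rightarrow> (nat \<Rightarrow> ix \<Rightarrow> complex mat) \<Rightarrow> complex mat set" where
  "Omega1 N R = {msum (Hdim N) (map (\<lambda>(a, b). Lm a * comm (Dop N R) (Lm b)) ps) | ps.
                   set ps \<subseteq> Aalg N \<times> Aalg N}"

text \<open>J^2 = { sum_j [D,a_j][D,b_j] : sum_j a_j [D,b_j] = 0 }; Omega^2 = S / J^2, so an
  identity in Omega^2 between elements of S means their difference lies in J^2.\<close>
definition J2 :: "nat \<Rightarrow> (nat \<Rightarrow> ix \<Rightarrow> complex mat) \<Rightarrow> complex mat set" where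
  "J2 N R = {msum (Hdim N) (map (\<lambda>(a, b). comm (Dop N R) (Lm a) * comm (Dop N R) (Lm b)) ps) | ps.
               set ps \<subseteq> Aalg N \<times> Aalg N \<and>
               msum (Hdim N) (map (\<lambda>(a, b). Lm a * comm (Dop N R) (Lm b)) ps) = 0\<^sub>m (Hdim N) (Hdim N)}"

definition ebas :: "nat \<Rightarrow> ix \<Rightarrow> complex mat" where
  "ebas N k = kron (1\<^sub>m (Kdim N)) (sig k)"

text \<open>Coefficient of an element w = sum_k c_k \<otimes> sigma_k (every element of Omega^1 has
  this form) along sigma_j: c_j = -1/2 * partial trace of w against sigma_j.\<close>
definition coef :: "nat \<Rightarrow> ix \<Rightarrow> complex mat \<Rightarrow> complex mat" where
  "coef N j w = mat (Kdim N) (Kdim N)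
     (\<lambda>(i, i'). - (1/2) * (\<Sum>s<2. \<Sum>t<2. w $$ (i * 2 + s, i' * 2 + t) * sig j $$ (t, s)))"

text \<open>Since E is free with the central basis e_j, every element of E \<otimes>_{A_N} E is uniquely
  of the form sum_j e_j \<otimes> xi_j with xi_j in E; we represent it by xi :: ix => complex mat.
  Similarly elements of E \<otimes> E \<otimes> E are represented as sum_j e_j \<otimes> T_j with T_j in E \<otimes> E.\<close>

definition inEE :: "nat \<Rightarrow> (nat \<Rightarrow> ix \<Rightarrow> complex mat) \<Rightarrow> (ix \<Rightarrow> complex mat) \<Rightarrow> bool" where
  "inEE N R \<xi> \<longleftrightarrow> (\<forall>j. \<xi> j \<in> Omega1 N R)"

text \<open>w \<otimes>_A eta = sum_j e_j c_j \<otimes> eta = sum_j e_j \<otimes> c_j eta.\<close>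
definition tens :: "nat \<Rightarrow> complex mat \<Rightarrow> complex mat \<Rightarrow> ix \<Rightarrow> complex mat" where
  "tens N w \<eta> = (\<lambda>j. Lm (coef N j w) * \<eta>)"

text \<open>Wedge: multiplication (followed by the quotient map to Omega^2).\<close>
definition wedge_rep :: "nat \<Rightarrow> (ix \<Rightarrow> complex mat) \<Rightarrow> complex mat" where
  "wedge_rep N \<xi> = sum3 (\<lambda>j. ebas N j * \<xi> j)"

definition ker_wedge :: "nat \<Rightarrow> (nat \<Rightarrow> ix \<Rightarrow> complex mat) \<Rightarrow> (ix \<Rightarrow> complex mat) set" where
  "ker_wedge N R = {\<xi>. inEE N R \<xi> \<and> wedge_rep N \<xi> \<in> J2 N R}"

definition Fanti :: "nat \<Rightarrow> (nat \<Rightarrow> ix \<Rightarrow> complex mat) \<Rightarrow> (ix \<Rightarrow> complex mat) set" where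
  "Fanti N R = {\<xi>. inEE N R \<xi> \<and> (\<forall>j k. coef N k (\<xi> j) = - coef N j (\<xi> k))}"

text \<open>P_sym: the idempotent with image ker(wedge) and kernel F; sigma = 2 P_sym - 1.\<close>
definition Psym :: "nat \<Rightarrow> (nat \<Rightarrow> ix \<Rightarrow> complex mat) \<Rightarrow> (ix \<Rightarrow> complex mat) \<Rightarrow> ix \<Rightarrow> complex mat" where
  "Psym N R \<xi> = (THE p. p \<in> ker_wedge N R \<and> (\<lambda>j. \<xi> j - p j) \<in> Fanti N R)"

definition braid :: "nat \<Rightarrow> (nat \<Rightarrow> ix \<Rightarrow> complex mat) \<Rightarrow> (ix \<Rightarrow> complex mat) \<Rightarrow> ix \<Rightarrow> complex mat" where
  "braid N R \<xi> = (\<lambda>j. 2 \<cdot>\<^sub>m Psym N R \<xi> j - \<xi> j)"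

text \<open>The canonical metric: right A-linear with g(e_k \<otimes> e_j) = delta_kj.
  g(sum_j e_j \<otimes> xi_j) = sum_j coef_j(xi_j).\<close>
definition gmet :: "nat \<Rightarrow> (ix \<Rightarrow> complex mat) \<Rightarrow> complex mat" where
  "gmet N \<xi> = sum3 (\<lambda>j. coef N j (\<xi> j))"

text \<open>(g \<otimes> id)(sum_{j,k} e_j \<otimes> e_k \<otimes> T_jk) = sum_j T_jj.\<close>
definition g_id :: "(ix \<Rightarrow> ix \<Rightarrow> complex mat) \<Rightarrow> complex mat" where
  "g_id T = sum3 (\<lambda>j. T j j)"

definition connection :: "nat \<Rightarrow> (nat \<Rightarrow> ix \<Rightarrow> complex mat) \<Rightarrow> (complex mat \<Rightarrow> ix \<Rightarrow> complex mat) \<Rightarrow> bool" where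
  "connection N R nabla \<longleftrightarrow>
     (\<forall>w\<in>Omega1 N R. inEE N R (nabla w)) \<and>
     (\<forall>w\<in>Omega1 N R. \<forall>w'\<in>Omega1 N R. nabla (w + w') = (\<lambda>j. nabla w j + nabla w' j)) \<and>
     (\<forall>w\<in>Omega1 N R. \<forall>c. nabla (c \<cdot>\<^sub>m w) = (\<lambda>j. c \<cdot>\<^sub>m nabla w j)) \<and>
     (\<forall>w\<in>Omega1 N R. \<forall>a\<in>Aalg N.
        nabla (w * Lm a) = (\<lambda>j. nabla w j * Lm a + tens N w (comm (Dop N R) (Lm a)) j))"

text \<open>Torsionless: wedge(nabla w) + d w = 0 in Omega^2, for w = sum a_j [D,b_j], where
  d w is the class of sum [D,a_j][D,b_j].\<close>
definition torsionless :: "nat \<Rightarrow> (nat \<Rightarrow> ix \<Rightarrow> complex mat) \<Rightarrow> (complex mat \<Rightarrow> ix \<Rightarrow> complex mat) \<Rightarrow> bool" where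
  "torsionless N R nabla \<longleftrightarrow>
     (\<forall>ps. set ps \<subseteq> Aalg N \<times> Aalg N \<longrightarrow>
        wedge_rep N (nabla (msum (Hdim N) (map (\<lambda>(a, b). Lm a * comm (Dop N R) (Lm b)) ps)))
        + msum (Hdim N) (map (\<lambda>(a, b). comm (Dop N R) (Lm a) * comm (Dop N R) (Lm b)) ps)
        \<in> J2 N R)"

definition centerE :: "nat \<Rightarrow> (nat \<Rightarrow> ix \<Rightarrow> complex mat) \<Rightarrow> complex mat set" where
  "centerE N R = {w \<in> Omega1 N R. \<forall>a\<in>Aalg N. Lm a * w = w * Lm a}"

text \<open>(g \<otimes> id)(sigma_23(nabla w \<otimes> eta) + w \<otimes> nabla eta) = d(g(w \<otimes> eta)).
  Here nabla w \<otimes> eta = sum_j e_j \<otimes> (nabla w_j \<otimes> eta), and with w = sum_j e_j c_j,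
  w \<otimes> nabla eta = sum_j e_j \<otimes> c_j nabla eta.\<close>
definition compatible :: "nat \<Rightarrow> (nat \<Rightarrow> ix \<Rightarrow> complex mat) \<Rightarrow> (complex mat \<Rightarrow> ix \<Rightarrow> complex mat) \<Rightarrow> bool" where
  "compatible N R nabla \<longleftrightarrow>
     (\<forall>w\<in>centerE N R. \<forall>\<eta>\<in>centerE N R.
        g_id (\<lambda>j k. braid N R (tens N (nabla w j) \<eta>) k + Lm (coef N j w) * nabla \<eta> k)
        = comm (Dop N R) (Lm (gmet N (tens N w \<eta>))))"

end

(* The algebra A is a full matrix algebra, so tensors sum_p E_pi (x) E_jp of matrix units turn the commutators
   [X_k, -] into scalars X_k(i,j). Applied to the trivial and the spin one half summands of K_N this shows
   that Omega^1 is all of A (x) span(sigma_k) and that J^2 is all of A (x) 1. Hence ker wedge consists of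
   the symmetric tensors, sigma is the flip, and modulo J^2 one has d e_k = e_k. For the Christoffel symbols
   metric compatibility then means antisymmetry in (j, k), while vanishing torsion fixes the antisymmetric
   part in (j, l); as in Koszul's formula, the two determine the symbols uniquely. *)
theory Submission
  imports Defs
begin

text \<open>A list of pairs (a, b) matters only through Y_q = sum a [X_q, b] and W = sum a Delta(b),
  where Delta(b) = sum_k [X_k, [X_k, b]]. In the sum of the [D, a][D, b], the part along the sigma_m
  is a function of Y alone, while W enters only the part in A (x) 1. Hence Omega^1 and J^2 are known
  once it is known which (Y, W) occur. These form a left A-module, so it is enough to reach Y = e_k
  with some W, and the pair (0, 1). For the first, the tensors of matrix units are weighted by
  entries of X_k on the spin one half block, where the trace form is c times the identity with c
  nonzero. For the second, diagonal units of the two blocks are combined with total weight zero: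
  this cancels Y, and W survives because the Casimir has trace 3c on one block and 0 on the other.
  The relation [X_1, X_2] = X_3 enters the differential through the Jacobi identity as an extra term
  Y_m, the source of d e_k = e_k. The factor 1/2 arises because the three cyclic Christoffel symbols
  have pairwise sums 1.\<close>

primrec nx :: "ix \<Rightarrow> ix" where
  "nx i1 = i2" | "nx i2 = i3" | "nx i3 = i1"

section \<open>Matrix sums and commutators\<close>

lemma mat_eq_carrierI:
  assumes "A \<in> carrier_mat m n" "B \<in> carrier_mat m n"
    and "\<And>i j. i < m \<Longrightarrow> j < n \<Longrightarrow> A $$ (i, j) = B $$ (i, j)"
  shows "A = B"
  using assms by (intro eq_matI) auto

lemma square_mult_carrier [simp]:
  "A \<in> carrier_mat n n \<Longrightarrow> B \<in> carrier_mat n n \<Longrightarrow> A * B \<in> carrier_mat n n"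
  by (rule mult_carrier_mat)

lemma square_minus_carrier [simp]:
  "A \<in> carrier_mat n n \<Longrightarrow> B \<in> carrier_mat n n \<Longrightarrow> A - B \<in> carrier_mat n n"
  by (rule minus_carrier_mat)

lemma sum3_carrier [simp]:
  assumes "\<And>k. f k \<in> carrier_mat m n"
  shows "sum3 f \<in> carrier_mat m n"
  using assms by (auto simp: sum3_def intro!: add_carrier_mat)

lemma comm_carrier [simp]:
  "A \<in> carrier_mat n n \<Longrightarrow> B \<in> carrier_mat n n \<Longrightarrow> comm A B \<in> carrier_mat n n"
  unfolding comm_def by (metis minus_carrier_mat mult_carrier_mat)

lemma msum_Nil [simp]: "msum n [] = 0\<^sub>m n n"
  and msum_Cons [simp]: "msum n (A # As) = A + msum n As"
  by (simp_all add: msum_def)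

lemma msum_carrier [simp]:
  "(\<And>A. A \<in> set As \<Longrightarrow> A \<in> carrier_mat n n) \<Longrightarrow> msum n As \<in> carrier_mat n n"
  by (induction As) auto

lemma msum_append:
  assumes "\<And>A. A \<in> set As \<union> set Bs \<Longrightarrow> A \<in> carrier_mat n n"
  shows "msum n (As @ Bs) = msum n As + msum n Bs"
  using assms
proof (induction As)
  case Nil
  then show ?case by (simp add: left_add_zero_mat[of _ n n])
next
  case (Cons A As)
  then show ?case
    by (simp add: assoc_add_mat[of _ n n])
qed

text \<open>The Leibniz rule, solved for the term that occurs in [D, a][D, b]: it trades a product
  of commutators for the commutator with a one-form coefficient and a double commutator.\<close>

lemma comm_mult_eq:
  assumes [simp]: "x \<in> carrier_mat n n" "a \<in> carrier_mat n n" "b \<in> carrier_mat n n"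
  shows "comm x a * b = comm x (a * b) - a * comm x b"
proof -
  have "comm x a * b = x * a * b - a * x * b"
    by (simp add: comm_def minus_mult_distrib_mat[of _ n n _ _ n] assoc_mult_mat[of _ n n _ n _ n])
  moreover have "comm x (a * b) = x * a * b - a * b * x"
    by (simp add: comm_def assoc_mult_mat[of _ n n _ n _ n])
  moreover have "a * comm x b = a * x * b - a * b * x"
    by (simp add: comm_def mult_minus_distrib_mat[of _ n n _ n] assoc_mult_mat[of _ n n _ n _ n])
  moreover have "x * a * b \<in> carrier_mat n n" "a * x * b \<in> carrier_mat n n" "a * b * x \<in> carrier_mat n n"
    by simp_all
  ultimately show ?thesis
    using assms[THEN carrier_matD(1)] assms[THEN carrier_matD(2)]
    by (intro mat_eq_carrierI[of _ n n]) (auto simp del: index_mult_mat(1))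
qed

lemma comm_jacobi:
  assumes [simp]: "x \<in> carrier_mat n n" "y \<in> carrier_mat n n" "b \<in> carrier_mat n n"
  shows "comm x (comm y b) - comm y (comm x b) = comm (comm x y) b"
proof -
  have "comm x (comm y b) = (x * y * b - x * b * y) - (y * b * x - b * y * x)"
    by (simp add: comm_def minus_mult_distrib_mat[of _ n n _ _ n] mult_minus_distrib_mat[of _ n n _ n] assoc_mult_mat[of _ n n _ n _ n])
  moreover have "comm y (comm x b) = (y * x * b - y * b * x) - (x * b * y - b * x * y)"
    by (simp add: comm_def minus_mult_distrib_mat[of _ n n _ _ n] mult_minus_distrib_mat[of _ n n _ n] assoc_mult_mat[of _ n n _ n _ n])
  moreover have "comm (comm x y) b = (x * y * b - y * x * b) - (b * x * y - b * y * x)"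
    by (simp add: comm_def minus_mult_distrib_mat[of _ n n _ _ n] mult_minus_distrib_mat[of _ n n _ n] assoc_mult_mat[of _ n n _ n _ n])
  moreover have "x * y * b \<in> carrier_mat n n" "x * b * y \<in> carrier_mat n n" "y * b * x \<in> carrier_mat n n"
     "b * y * x \<in> carrier_mat n n" "y * x * b \<in> carrier_mat n n" "b * x * y \<in> carrier_mat n n"
    by simp_all
  ultimately show ?thesis
    using assms[THEN carrier_matD(1)] assms[THEN carrier_matD(2)]
    by (intro mat_eq_carrierI[of _ n n]) (auto simp del: index_mult_mat(1))
qed

section \<open>Kronecker products with a 2 by 2 second factor\<close>

lemma kron_carrier [simp]:
  "A \<in> carrier_mat n n \<Longrightarrow> B \<in> carrier_mat m m \<Longrightarrow> kron A B \<in> carrier_mat (n * m) (n * m)"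
  by (auto simp: kron_def)

lemma dim_kron [simp]:
  "dim_row (kron A B) = dim_row A * dim_row B" "dim_col (kron A B) = dim_col A * dim_col B"
  by (simp_all add: kron_def)

lemma kron_index:
  assumes "dim_row B = 2" "dim_col B = 2" "i < dim_row A * 2" "j < dim_col A * 2"
  shows "kron A B $$ (i, j) = A $$ (i div 2, j div 2) * B $$ (i mod 2, j mod 2)"
  using assms by (auto simp: kron_def)

lemma kron_add_left:
  assumes "A \<in> carrier_mat n n" "B \<in> carrier_mat n n" "C \<in> carrier_mat 2 2"
  shows "kron (A + B) C = kron A C + kron B C"
  using assms by (intro eq_matI) (auto simp: kron_index algebra_simps)

lemma kron_smult_left:
  assumes "A \<in> carrier_mat n n" "C \<in> carrier_mat 2 2"
  shows "kron (c \<cdot>\<^sub>m A) C = c \<cdot>\<^sub>m kron A C"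
  using assms by (intro eq_matI) (auto simp: kron_index algebra_simps)

text \<open>An index of K_N (x) C^2 is 2p + s with s in {0, 1}; this splits a matrix product over
  such indices into its two tensor factors.\<close>

lemma sum_lessThan_double: "(\<Sum>k<n * 2. f k) = (\<Sum>p<n. f (p * 2) + f (p * 2 + 1 :: nat))"
  for f :: "nat \<Rightarrow> 'a::comm_monoid_add"
  by (induction n) (simp_all add: ac_simps)

lemma kron_mult:
  assumes "A \<in> carrier_mat n n" "B \<in> carrier_mat 2 2" "C \<in> carrier_mat n n" "E \<in> carrier_mat 2 2"
  shows "kron A B * kron C E = kron (A * C) (B * E)"
proof (rule eq_matI)
  note [simp] = assms[THEN carrier_matD(1)] assms[THEN carrier_matD(2)]
  fix i j assume "i < dim_row (kron (A * C) (B * E))" "j < dim_col (kron (A * C) (B * E))"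
  then have ij: "i < n * 2" "j < n * 2" by simp_all
  then have ij': "i div 2 < n" "j div 2 < n" "i mod 2 < 2" "j mod 2 < 2" by auto
  have "(kron A B * kron C E) $$ (i, j) = (\<Sum>k<n * 2. kron A B $$ (i, k) * kron C E $$ (k, j))"
    using ij by (auto simp: scalar_prod_def lessThan_atLeast0)
  also have "\<dots> = (\<Sum>p<n. A $$ (i div 2, p) * C $$ (p, j div 2) *
      (B $$ (i mod 2, 0) * E $$ (0, j mod 2) + B $$ (i mod 2, 1) * E $$ (1, j mod 2)))"
    unfolding sum_lessThan_double using ij
    by (intro sum.cong) (auto simp: kron_index algebra_simps mod_Suc)
  also have "\<dots> = (A * C) $$ (i div 2, j div 2) * (B * E) $$ (i mod 2, j mod 2)"
  proof -
    have "(A * C) $$ (i div 2, j div 2) = (\<Sum>p<n. A $$ (i div 2, p) * C $$ (p, j div 2))"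
      using ij' by (auto simp: scalar_prod_def lessThan_atLeast0)
    moreover have "(B * E) $$ (i mod 2, j mod 2) =
        B $$ (i mod 2, 0) * E $$ (0, j mod 2) + B $$ (i mod 2, 1) * E $$ (1, j mod 2)"
      using ij' by (auto simp: scalar_prod_def numeral_2_eq_2)
    ultimately show ?thesis by (simp add: sum_distrib_right)
  qed
  also have "\<dots> = kron (A * C) (B * E) $$ (i, j)"
    using ij by (simp add: kron_index)
  finally show "(kron A B * kron C E) $$ (i, j) = kron (A * C) (B * E) $$ (i, j)" .
qed (use assms in simp_all)

section \<open>Pauli matrices and elements of A (x) span(sigma_k)\<close>

lemma less_2_cases': "(i::nat) < 2 \<Longrightarrow> (i = 0 \<Longrightarrow> P) \<Longrightarrow> (i = Suc 0 \<Longrightarrow> P) \<Longrightarrow> P"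
  by linarith

lemma sig_carrier [simp]: "sig k \<in> carrier_mat 2 2"
  by (cases k) (auto simp: sig_def tau_def mat_of_rows_list_def)

lemma sig_index:
  "sig i1 $$ (0, 0) = 0" "sig i1 $$ (0, Suc 0) = \<i>" "sig i1 $$ (Suc 0, 0) = \<i>" "sig i1 $$ (Suc 0, Suc 0) = 0"
  "sig i2 $$ (0, 0) = 0" "sig i2 $$ (0, Suc 0) = 1" "sig i2 $$ (Suc 0, 0) = -1" "sig i2 $$ (Suc 0, Suc 0) = 0"
  "sig i3 $$ (0, 0) = \<i>" "sig i3 $$ (0, Suc 0) = 0" "sig i3 $$ (Suc 0, 0) = 0" "sig i3 $$ (Suc 0, Suc 0) = -\<i>"
  by (auto simp: sig_def tau_def mat_of_rows_list_def)

lemma sig_mult_index: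
  assumes "s < 2" "t < 2"
  shows "(sig k * sig l) $$ (s, t) = sig k $$ (s, 0) * sig l $$ (0, t) + sig k $$ (s, Suc 0) * sig l $$ (Suc 0, t)"
  using assms sig_carrier[of k] sig_carrier[of l]
  by (auto simp: scalar_prod_def numeral_2_eq_2)

text \<open>The factor i in \<open>sig\<close> turns the Pauli relations into those of quaternion
  units, up to orientation. Since \<open>nx\<close> is the cyclic shift of the indices, one formula
  covers the three cases of each sign.\<close>

lemma sig_mult_self: "sig k * sig k = (-1) \<cdot>\<^sub>m 1\<^sub>m 2"
  and sig_mult_nx: "sig (nx m) * sig (nx (nx m)) = (-1) \<cdot>\<^sub>m sig m"
  and sig_mult_nx': "sig (nx (nx m)) * sig (nx m) = sig m"
proof -
  have eqI: "A = B" if "A \<in> carrier_mat 2 2" "B \<in> carrier_mat 2 2"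
    "A $$ (0, 0) = B $$ (0, 0)" "A $$ (0, Suc 0) = B $$ (0, Suc 0)"
    "A $$ (Suc 0, 0) = B $$ (Suc 0, 0)" "A $$ (Suc 0, Suc 0) = B $$ (Suc 0, Suc 0)"
    for A B :: "complex mat"
    using that by (intro mat_eq_carrierI[of _ 2 2]) (auto elim!: less_2_cases')
  note [simp] = carrier_matD[OF sig_carrier]
  show "sig k * sig k = (-1) \<cdot>\<^sub>m 1\<^sub>m 2"
    by (rule eqI; cases k; simp add: sig_mult_index sig_index del: index_mult_mat(1))
  show "sig (nx m) * sig (nx (nx m)) = (-1) \<cdot>\<^sub>m sig m"
    by (rule eqI; cases m; simp add: sig_mult_index sig_index del: index_mult_mat(1))
  show "sig (nx (nx m)) * sig (nx m) = sig m"
    by (rule eqI; cases m; simp add: sig_mult_index sig_index del: index_mult_mat(1))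
qed

text \<open>The normal form in which one-forms are handled: \<open>Dop\<close>, each
  \<open>ebas\<close> and, by \<open>Omega1_eq\<close>, every element of \<open>Omega1\<close> have
  this shape, so that later computations run on the coefficients \<open>c\<close>.\<close>

definition vf :: "(ix \<Rightarrow> complex mat) \<Rightarrow> complex mat" where
  "vf c = sum3 (\<lambda>k. kron (c k) (sig k))"

lemma vf_carrier [simp]: "(\<And>k. c k \<in> carrier_mat n n) \<Longrightarrow> vf c \<in> carrier_mat (n * 2) (n * 2)"
  by (simp add: vf_def)

lemma vf_index:
  assumes "\<And>k. c k \<in> carrier_mat n n" "i < n * 2" "j < n * 2"
  shows "vf c $$ (i, j) = sum3 (\<lambda>k. c k $$ (i div 2, j div 2) * sig k $$ (i mod 2, j mod 2))"
proof -
  note [simp] = assms(1)[THEN carrier_matD(1)] assms(1)[THEN carrier_matD(2)] carrier_matD[OF sig_carrier]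
  show ?thesis using assms(2,3) by (simp add: vf_def sum3_def kron_index)
qed

lemma vf_add:
  assumes "\<And>k. c k \<in> carrier_mat n n" "\<And>k. c' k \<in> carrier_mat n n"
  shows "vf c + vf c' = vf (\<lambda>k. c k + c' k)"
proof (rule mat_eq_carrierI[of _ "n * 2" "n * 2"])
  fix i j assume ij: "i < n * 2" "j < n * 2"
  note [simp] = assms[THEN carrier_matD(1)] assms[THEN carrier_matD(2)] 
     vf_carrier[of c, OF assms(1), THEN carrier_matD(1)] vf_carrier[of c, OF assms(1), THEN carrier_matD(2)]
     vf_carrier[of c', OF assms(2), THEN carrier_matD(1)] vf_carrier[of c', OF assms(2), THEN carrier_matD(2)]
  from ij show "(vf c + vf c') $$ (i, j) = vf (\<lambda>k. c k + c' k) $$ (i, j)"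
    using assms by (auto simp: vf_index[of _ n] sum3_def algebra_simps)
qed (use assms in simp_all)

lemma vf_smult:
  assumes "\<And>k. c k \<in> carrier_mat n n"
  shows "a \<cdot>\<^sub>m vf c = vf (\<lambda>k. a \<cdot>\<^sub>m c k)"
proof (rule mat_eq_carrierI[of _ "n * 2" "n * 2"])
  fix i j assume ij: "i < n * 2" "j < n * 2"
  note [simp] = assms[THEN carrier_matD(1)] assms[THEN carrier_matD(2)] 
     vf_carrier[of c, OF assms(1), THEN carrier_matD(1)] vf_carrier[of c, OF assms(1), THEN carrier_matD(2)]
  from ij show "(a \<cdot>\<^sub>m vf c) $$ (i, j) = vf (\<lambda>k. a \<cdot>\<^sub>m c k) $$ (i, j)"
    using assms by (auto simp: vf_index[of _ n] sum3_def algebra_simps)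
qed (use assms in simp_all)

lemma mat_minus_eq: "A \<in> carrier_mat m n \<Longrightarrow> B \<in> carrier_mat m n \<Longrightarrow> A - B = A + (-1) \<cdot>\<^sub>m (B :: complex mat)"
  by (intro eq_matI) auto

lemma vf_minus:
  assumes "\<And>k. c k \<in> carrier_mat n n" "\<And>k. c' k \<in> carrier_mat n n"
  shows "vf c - vf c' = vf (\<lambda>k. c k - c' k)"
  using assms by (simp add: mat_minus_eq[of _ "n * 2" "n * 2"] mat_minus_eq[of _ n n] vf_smult[of _ n] vf_add[of _ n])

lemma vf_zero: "vf (\<lambda>k. 0\<^sub>m n n) = 0\<^sub>m (n * 2) (n * 2)"
  by (rule mat_eq_carrierI[of _ "n * 2" "n * 2"]) (auto simp: vf_index[of _ n] sum3_def)

lemma kron_zero: "B \<in> carrier_mat 2 2 \<Longrightarrow> kron (0\<^sub>m n n) B = 0\<^sub>m (n * 2) (n * 2)"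
  by (rule eq_matI) (auto simp: kron_index)

text \<open>Adding a multiple of the identity does not change the coefficients, since the Pauli matrices are traceless.\<close>
lemma coef_kron_vf:
  assumes "\<And>k. c k \<in> carrier_mat (Kdim N) (Kdim N)" "z \<in> carrier_mat (Kdim N) (Kdim N)"
  shows "coef N j (kron z (1\<^sub>m 2) + vf c) = c j"
proof (rule mat_eq_carrierI[of _ "Kdim N" "Kdim N"])
  fix i i' assume ij: "i < Kdim N" "i' < Kdim N"
  note [simp] = assms(2)[THEN carrier_matD(1)] assms(2)[THEN carrier_matD(2)] assms(1)[THEN carrier_matD(1)] assms(1)[THEN carrier_matD(2)] 
     vf_carrier[of c, OF assms(1), THEN carrier_matD(1)] vf_carrier[of c, OF assms(1), THEN carrier_matD(2)]
  have sum2: "(\<Sum>s<2. f s) = f 0 + f (Suc 0)" for f :: "nat \<Rightarrow> complex"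
    by (simp add: numeral_2_eq_2)
  have odd: "Suc (p * 2) mod 2 = Suc 0" "Suc (p * 2) div 2 = p" for p by presburger+
  show "coef N j (kron z (1\<^sub>m 2) + vf c) $$ (i, i') = c j $$ (i, i')"
    using ij by (cases j) (simp_all add: coef_def sum2 odd vf_index[OF assms(1)] kron_index sum3_def sig_index field_simps)
qed (use assms in \<open>auto simp: coef_def\<close>)

lemma coef_vf:
  assumes "\<And>k. c k \<in> carrier_mat (Kdim N) (Kdim N)"
  shows "coef N j (vf c) = c j"
proof -
  have "kron (0\<^sub>m (Kdim N) (Kdim N)) (1\<^sub>m 2) + vf c = vf c"
    using assms by (simp add: kron_zero left_add_zero_mat[of _ "Kdim N * 2" "Kdim N * 2"])
  with coef_kron_vf[of c N "0\<^sub>m (Kdim N) (Kdim N)" j] assms show ?thesis by simp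
qed

lemma Lm_mult_vf:
  assumes "a \<in> carrier_mat n n" "\<And>k. c k \<in> carrier_mat n n"
  shows "Lm a * vf c = vf (\<lambda>k. a * c k)"
  using assms
  by (simp add: Lm_def vf_def sum3_def left_mult_one_mat[OF sig_carrier] mult_add_distrib_mat[of _ "n * 2" "n * 2" _ "n * 2"] kron_mult[of _ n])

lemma vf_mult_Lm:
  assumes "a \<in> carrier_mat n n" "\<And>k. c k \<in> carrier_mat n n"
  shows "vf c * Lm a = vf (\<lambda>k. c k * a)"
  using assms
  by (simp add: Lm_def vf_def sum3_def right_mult_one_mat[OF sig_carrier] add_mult_distrib_mat[of _ "n * 2" "n * 2" _ _ "n * 2"] kron_mult[of _ n])

lemma kron_sig_mult_vf:
  assumes "a \<in> carrier_mat n n" "\<And>k. c k \<in> carrier_mat n n"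
  shows "kron a (sig k) * vf c = sum3 (\<lambda>l. kron (a * c l) (sig k * sig l))"
  using assms
  by (simp add: vf_def sum3_def mult_add_distrib_mat[of _ "n * 2" "n * 2" _ "n * 2"] kron_mult[of _ n])

text \<open>Quaternion multiplication: equal indices give -1, distinct ones plus or minus the third
  sigma. So the part in A (x) 1 sees the trace of \<open>K\<close>, and the sigma part sees only its
  antisymmetric part.\<close>

lemma sum3_kron_sig_mult:
  assumes K: "\<And>k l. K k l \<in> carrier_mat n n"
  shows "sum3 (\<lambda>k. sum3 (\<lambda>l. kron (K k l) (sig k * sig l)))
    = kron ((-1) \<cdot>\<^sub>m sum3 (\<lambda>k. K k k)) (1\<^sub>m 2)
      + vf (\<lambda>m. K (nx (nx m)) (nx m) - K (nx m) (nx (nx m)))"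
proof -
  have s: "sig i2 * sig i3 = (-1) \<cdot>\<^sub>m sig i1" "sig i3 * sig i1 = (-1) \<cdot>\<^sub>m sig i2" "sig i1 * sig i2 = (-1) \<cdot>\<^sub>m sig i3"
    "sig i3 * sig i2 = sig i1" "sig i1 * sig i3 = sig i2" "sig i2 * sig i1 = sig i3"
    using sig_mult_nx[of i1] sig_mult_nx[of i2] sig_mult_nx[of i3]
      sig_mult_nx'[of i1] sig_mult_nx'[of i2] sig_mult_nx'[of i3] by simp_all
  note [simp] = K[THEN carrier_matD(1)] K[THEN carrier_matD(2)]
  show ?thesis
    by (intro eq_matI) (simp_all add: sum3_def sig_mult_self s vf_def kron_index carrier_matD[OF sig_carrier]
        algebra_simps del: index_mult_mat)
qed

lemma vf_mult_vf:
  assumes c: "\<And>k. c k \<in> carrier_mat n n" and c': "\<And>k. c' k \<in> carrier_mat n n"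
  shows "vf c * vf c' = kron ((-1) \<cdot>\<^sub>m sum3 (\<lambda>k. c k * c' k)) (1\<^sub>m 2)
    + vf (\<lambda>m. c (nx (nx m)) * c' (nx m) - c (nx m) * c' (nx (nx m)))"
proof -
  have "vf c * vf c' = sum3 (\<lambda>k. kron (c k) (sig k) * vf c')"
    using c vf_carrier[of c', OF c'] unfolding vf_def[of c] sum3_def
    by (simp add: add_mult_distrib_mat[of _ "n * 2" "n * 2" _ _ "n * 2"])
  also have "\<dots> = sum3 (\<lambda>k. sum3 (\<lambda>l. kron (c k * c' l) (sig k * sig l)))"
    using c c' by (simp add: kron_sig_mult_vf[of _ n])
  finally show ?thesis using c c' by (simp add: sum3_kron_sig_mult[of _ n])
qed

lemma vf_comm_Lm:
  assumes "a \<in> carrier_mat n n" "\<And>k. c k \<in> carrier_mat n n"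
  shows "comm (vf c) (Lm a) = vf (\<lambda>k. comm (c k) a)"
  using assms by (simp add: comm_def vf_mult_Lm[of _ n] Lm_mult_vf[of _ n] vf_minus[of _ n])

lemma ebas_eq_vf:
  "ebas N k = vf (\<lambda>l. if l = k then 1\<^sub>m (Kdim N) else 0\<^sub>m (Kdim N) (Kdim N))"
  by (cases k) (simp_all add: ebas_def vf_def sum3_def kron_zero left_add_zero_mat[of _ "Kdim N * 2" "Kdim N * 2"]
     right_add_zero_mat[of _ "Kdim N * 2" "Kdim N * 2"])

section \<open>Direct sums and representations of su(2)\<close>

lemma dsum_carrier [simp]:
  "A \<in> carrier_mat n n \<Longrightarrow> B \<in> carrier_mat m m \<Longrightarrow> dsum A B \<in> carrier_mat (n + m) (n + m)"
  by (auto simp: dsum_def)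

lemma comm_dsum:
  assumes "A \<in> carrier_mat n n" "B \<in> carrier_mat m m" "A' \<in> carrier_mat n n" "B' \<in> carrier_mat m m"
  shows "comm (dsum A B) (dsum A' B') = dsum (comm A A') (comm B B')"
proof -
  have m: "dsum A B * dsum A' B' = dsum (A * A') (B * B')"
    if "A \<in> carrier_mat n n" "B \<in> carrier_mat m m" "A' \<in> carrier_mat n n" "B' \<in> carrier_mat m m"
    for A B A' B'
    using that unfolding dsum_def
    by (subst mult_four_block_mat[of _ n n _ m _ m _ _ n _ m])
      (auto simp: left_add_zero_mat[of _ m m] right_add_zero_mat[of _ n n])
  have "dsum A B - dsum A' B' = dsum (A - A') (B - B')"
    if "A \<in> carrier_mat n n" "B \<in> carrier_mat m m" "A' \<in> carrier_mat n n" "B' \<in> carrier_mat m m"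
    for A B A' B'
    using that unfolding dsum_def by (intro eq_matI) auto
  with m show ?thesis using assms by (simp add: comm_def)
qed

text \<open>The triple (m, \<open>nx m\<close>, \<open>nx (nx m)\<close>) is an even permutation, so
  the Levi-Civita sum has a single term, with sign +1.\<close>

lemma su2_comm:
  assumes "su2_unitary_rep n \<rho>"
  shows "comm (\<rho> (nx m)) (\<rho> (nx (nx m))) = \<rho> m"
proof -
  have c: "\<And>k. \<rho> k \<in> carrier_mat n n"
    and "comm (\<rho> (nx m)) (\<rho> (nx (nx m))) = sum3 (\<lambda>l. lc (nx m) (nx (nx m)) l \<cdot>\<^sub>m \<rho> l)"
    using assms by (auto simp: su2_unitary_rep_def)
  moreover have "sum3 (\<lambda>l. lc (nx m) (nx (nx m)) l \<cdot>\<^sub>m \<rho> l) = \<rho> m"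
    using c[THEN carrier_matD(1)] c[THEN carrier_matD(2)]
    by (cases m; intro eq_matI; simp add: sum3_def lc_def)
  ultimately show ?thesis by simp
qed

text \<open>The long expression is the trace form tr(\<open>\<rho> k\<close>
  \<open>\<rho> l\<close>). Its invariance under commutators makes it c times the identity. By
  skew-Hermiticity c is minus a sum of squared moduli of entries, so c = 0 would make the
  representation zero, hence reducible in dimension 2.\<close>

lemma spin_half_trace_form:
  assumes rep: "su2_unitary_rep 2 \<rho>" and irr: "irreducible_rep 2 \<rho>"
  obtains c where "c \<noteq> 0" "\<And>k. \<rho> k $$ (0, 0) + \<rho> k $$ (Suc 0, Suc 0) = 0"
    "\<And>k l. \<rho> k $$ (0, 0) * \<rho> l $$ (0, 0) + \<rho> k $$ (0, Suc 0) * \<rho> l $$ (Suc 0, 0)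
       + \<rho> k $$ (Suc 0, 0) * \<rho> l $$ (0, Suc 0) + \<rho> k $$ (Suc 0, Suc 0) * \<rho> l $$ (Suc 0, Suc 0)
     = (if k = l then c else 0)"
proof -
  have car: "\<And>k. \<rho> k \<in> carrier_mat 2 2" and adj: "\<And>k. adj (\<rho> k) = - \<rho> k"
    using rep by (auto simp: su2_unitary_rep_def)
  note d [simp] = car[THEN carrier_matD(1)] car[THEN carrier_matD(2)]
  define x where "x = (\<lambda>k i j. \<rho> k $$ (i, j))"
  have comm: "x m i j = x (nx m) i 0 * x (nx (nx m)) 0 j + x (nx m) i (Suc 0) * x (nx (nx m)) (Suc 0) j
      - (x (nx (nx m)) i 0 * x (nx m) 0 j + x (nx (nx m)) i (Suc 0) * x (nx m) (Suc 0) j)" if "i < 2" "j < 2" for m i j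
  proof -
    have "comm (\<rho> (nx m)) (\<rho> (nx (nx m))) $$ (i, j) = \<rho> m $$ (i, j)"
      using su2_comm[OF rep] by simp
    then show ?thesis using that
      by (simp add: comm_def x_def scalar_prod_def numeral_2_eq_2)
  qed
  have tr: "x k 0 0 + x k (Suc 0) (Suc 0) = 0" for k
    using comm[of 0 0 k] comm[of "Suc 0" "Suc 0" k] by simp
  define T where "T = (\<lambda>k l. x k 0 0 * x l 0 0 + x k 0 (Suc 0) * x l (Suc 0) 0 + x k (Suc 0) 0 * x l 0 (Suc 0) + x k (Suc 0) (Suc 0) * x l (Suc 0) (Suc 0))"
  note cs = comm[of 0 0] comm[of 0 "Suc 0"] comm[of "Suc 0" 0] comm[of "Suc 0" "Suc 0"]
  have sym: "T k l = T l k" for k l by (simp add: T_def)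
  define e where "e = (\<lambda>m i j. x (nx m) i 0 * x (nx (nx m)) 0 j + x (nx m) i (Suc 0) * x (nx (nx m)) (Suc 0) j
      - (x (nx (nx m)) i 0 * x (nx m) 0 j + x (nx (nx m)) i (Suc 0) * x (nx m) (Suc 0) j))"
  have T_e: "T m k = e m 0 0 * x k 0 0 + e m 0 (Suc 0) * x k (Suc 0) 0 + e m (Suc 0) 0 * x k 0 (Suc 0)
      + e m (Suc 0) (Suc 0) * x k (Suc 0) (Suc 0)" for m k
    using cs[of m] unfolding T_def e_def by simp
  \<comment> \<open>With x = x_{m+1} and y = x_{m+2}, this is tr([x, y] x) = 0.\<close>
  have T0: "T m (nx m) = 0" for m
    unfolding T_e e_def by (simp add: algebra_simps)
  \<comment> \<open>Both sides are traces of the form tr([x, y] z) over the same three matrices,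
    cyclically rotated.\<close>
  have T1: "T m m = T (nx m) (nx m)" for m
  proof -
    have "nx (nx (nx m)) = m" by (cases m) auto
    then show ?thesis
      unfolding T_e e_def by (simp add: algebra_simps)
  qed
  define c where "c = T i1 i1"
  have T: "T k l = (if k = l then c else 0)" for k l
    using T0[of i1] T0[of i2] T0[of i3] T1[of i1] T1[of i2] sym
    by (cases k; cases l) (auto simp: c_def)
  have anti: "x k j i = - cnj (x k i j)" if "i < 2" "j < 2" for k i j
  proof -
    have "adj (\<rho> k) $$ (j, i) = (- \<rho> k) $$ (j, i)" by (simp add: adj)
    then have "cnj (x k i j) = - x k j i" using that by (simp add: adj_def x_def)
    then show ?thesis by simp
  qed
  have sq: "x k i j * x k j i = - of_real ((cmod (x k i j))\<^sup>2)" if "i < 2" "j < 2" for k i j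
    using anti[OF that, of k] complex_norm_square[of "x k i j"] by (metis mult_minus_right)
  have "c \<noteq> 0"
  proof
    assume "c = 0"
    have zero: "x k i j = 0" if ij: "i < 2" "j < 2" for k i j
    proof -
      have "T k k = 0" using T \<open>c = 0\<close> by simp
      moreover have "T k k = - of_real ((cmod (x k 0 0))\<^sup>2 + (cmod (x k 0 (Suc 0)))\<^sup>2 + (cmod (x k (Suc 0) 0))\<^sup>2 + (cmod (x k (Suc 0) (Suc 0)))\<^sup>2)"
        using sq[of 0 0 k] sq[of "Suc 0" "Suc 0" k] sq[of 0 "Suc 0" k] sq[of "Suc 0" 0 k] by (simp add: T_def)
      ultimately have "(cmod (x k 0 0))\<^sup>2 + (cmod (x k 0 (Suc 0)))\<^sup>2 + (cmod (x k (Suc 0) 0))\<^sup>2 + (cmod (x k (Suc 0) (Suc 0)))\<^sup>2 = 0"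
        by (metis neg_equal_0_iff_equal of_real_eq_0_iff)
      then have "x k 0 0 = 0 \<and> x k 0 (Suc 0) = 0 \<and> x k (Suc 0) 0 = 0 \<and> x k (Suc 0) (Suc 0) = 0"
        by (smt (verit) zero_le_power2 norm_eq_zero zero_eq_power2)
      then show ?thesis using ij by (auto elim!: less_2_cases')
    qed
    then have r0: "\<rho> k = 0\<^sub>m 2 2" for k
      by (intro eq_matI) (auto simp: x_def)
    \<comment> \<open>When all operators vanish every subspace is invariant; the first coordinate
      axis is a proper nonzero one.\<close>
    define W where "W = {v :: complex vec. v \<in> carrier_vec 2 \<and> v $ 1 = 0}"
    have "W = {0\<^sub>v 2} \<or> W = carrier_vec 2"
      using irr unfolding irreducible_rep_def
      by (elim allE[of _ W]) (auto simp: W_def r0 intro!: mult_mat_vec_carrier[of _ 2 2])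
    moreover have "unit_vec 2 0 \<in> W" "unit_vec 2 0 \<noteq> (0\<^sub>v 2 :: complex vec)"
      by (auto simp: W_def)
    moreover have "unit_vec 2 1 \<notin> W" "unit_vec 2 1 \<in> (carrier_vec 2 :: complex vec set)"
      by (auto simp: W_def)
    ultimately show False by auto
  qed
  then show thesis
    using that[of c] tr T by (simp add: T_def x_def)
qed

section \<open>The operators X_k on the first two summands of K_N\<close>

lemma Kdim_0 [simp]: "Kdim 0 = 1"
  and Kdim_Suc [simp]: "Kdim (Suc n) = Kdim n + (n + 2)"
  by (simp_all add: Kdim_def)

lemma three_le_Kdim: "1 \<le> n \<Longrightarrow> 3 \<le> Kdim n"
  by (induction n rule: dec_induct) auto

locale fuzzy_sphere =
  fixes N :: nat and R :: "nat \<Rightarrow> ix \<Rightarrow> complex mat"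
  assumes N_pos: "1 \<le> N" and irreps: "su2_irreps N R"
begin

lemma R_carrier: "n \<le> N \<Longrightarrow> R n k \<in> carrier_mat (n + 1) (n + 1)"
  using irreps by (simp add: su2_irreps_def su2_unitary_rep_def)

lemma Xop_carrier: "n \<le> N \<Longrightarrow> Xop R n k \<in> carrier_mat (Kdim n) (Kdim n)"
proof (induction n)
  case (Suc n)
  then show ?case using dsum_carrier[of "Xop R n k" "Kdim n" "R (Suc n) k" "n + 2"] R_carrier[of "Suc n" k] by simp
qed (use R_carrier[of 0] in simp)

lemma Xop_comm: "n \<le> N \<Longrightarrow> comm (Xop R n (nx m)) (Xop R n (nx (nx m))) = Xop R n m"
proof (induction n)
  case 0
  then show ?case using irreps su2_comm by (auto simp: su2_irreps_def)
next
  case (Suc n)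
  have "comm (R (Suc n) (nx m)) (R (Suc n) (nx (nx m))) = R (Suc n) m"
    using Suc.prems irreps by (intro su2_comm[of "Suc n + 1"]) (auto simp: su2_irreps_def)
  with Suc show ?case
    using Xop_carrier[of n] R_carrier[of "Suc n"]
    by (simp add: comm_dsum[of _ "Kdim n" _ "n + 2"])
qed

text \<open>Each operator of the representation is a commutator, and commutators vanish in dimension
  1.\<close>

lemma R_zero: "R 0 k $$ (0, 0) = 0"
proof -
  have "R 0 k = comm (R 0 (nx k)) (R 0 (nx (nx k)))"
    using su2_comm[of 1 "R 0"] irreps by (auto simp: su2_irreps_def)
  then show ?thesis
    using R_carrier[of 0, THEN carrier_matD(1)] R_carrier[of 0, THEN carrier_matD(2)]
    by (simp add: comm_def scalar_prod_def)
qed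

text \<open>The trivial summand sits at index 0 and the spin one half summand at 1 and 2; later
  summands are appended behind them. Whole rows are described, because squares of X_k are needed on
  the block.\<close>

lemma Xop_index:
  assumes "1 \<le> n" "n \<le> N" "i < 3" "j < Kdim n"
  shows "Xop R n k $$ (i, j) = (if 1 \<le> i \<and> 1 \<le> j \<and> j < 3 then R 1 k $$ (i - 1, j - 1) else 0)"
  using assms(1,2,4)
proof (induction n rule: dec_induct)
  case base
  then show ?case
    using \<open>i < 3\<close> R_carrier[of 0 k] R_carrier[of 1 k] by (auto simp: dsum_def R_zero)
next
  case (step n)
  have "Xop R n k \<in> carrier_mat (Kdim n) (Kdim n)" "R (Suc n) k \<in> carrier_mat (n + 2) (n + 2)"
    using step.prems Xop_carrier[of n k] R_carrier[of "Suc n" k] by auto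
  moreover have "3 \<le> Kdim n" using three_le_Kdim step.hyps by simp
  ultimately show ?case
    using step \<open>i < 3\<close> by (auto simp: dsum_def)
qed

end

section \<open>Matrix units\<close>

lemma msum_map_index:
  assumes "\<And>p. p \<in> set ps \<Longrightarrow> f p \<in> carrier_mat n n" "r < n" "s < n"
  shows "msum n (map f ps) $$ (r, s) = (\<Sum>p\<leftarrow>ps. f p $$ (r, s))"
  using assms
proof (induction ps)
  case (Cons p ps)
  have "msum n (map f ps) \<in> carrier_mat n n" using Cons.prems by (intro msum_carrier) auto
  then show ?case using Cons by (auto simp: carrier_matD)
qed simp

definition munit :: "nat \<Rightarrow> nat \<Rightarrow> nat \<Rightarrow> complex mat" where
  "munit n i j = mat n n (\<lambda>(r, s). if r = i \<and> s = j then 1 else 0)"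

lemma munit_carrier [simp]: "munit n i j \<in> carrier_mat n n"
  by (simp add: munit_def)

lemma munit_index: "r < n \<Longrightarrow> s < n \<Longrightarrow> munit n i j $$ (r, s) = (if r = i \<and> s = j then 1 else 0)"
  by (simp add: munit_def)

lemma mult_mat_index:
  fixes B C :: "complex mat"
  assumes "B \<in> carrier_mat n n" "C \<in> carrier_mat n n" "r < n" "s < n"
  shows "(B * C) $$ (r, s) = (\<Sum>p<n. B $$ (r, p) * C $$ (p, s))"
  using assms by (simp add: scalar_prod_def lessThan_atLeast0)

lemma munit_mult_index:
  assumes "B \<in> carrier_mat n n" "i < n" "j < n" "r < n" "s < n"
  shows "(munit n i j * B) $$ (r, s) = (if r = i then B $$ (j, s) else 0)"
    and "(B * munit n i j) $$ (r, s) = (if s = j then B $$ (r, i) else 0)"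
proof -
  have "(munit n i j * B) $$ (r, s) = (\<Sum>p<n. (if r = i \<and> p = j then 1 else 0) * B $$ (p, s))"
    using assms by (simp add: mult_mat_index[of _ n] munit_index del: index_mult_mat)
  also have "\<dots> = (\<Sum>p<n. if p = j then (if r = i then B $$ (j, s) else 0) else 0)"
    by (rule sum.cong) auto
  finally show "(munit n i j * B) $$ (r, s) = (if r = i then B $$ (j, s) else 0)"
    using assms by simp
  have "(B * munit n i j) $$ (r, s) = (\<Sum>p<n. B $$ (r, p) * (if p = i \<and> s = j then 1 else 0))"
    using assms by (simp add: mult_mat_index[of _ n] munit_index del: index_mult_mat)
  also have "\<dots> = (\<Sum>p<n. if p = i then (if s = j then B $$ (r, i) else 0) else 0)"
    by (rule sum.cong) auto
  finally show "(B * munit n i j) $$ (r, s) = (if s = j then B $$ (r, i) else 0)"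
    using assms by simp
qed

text \<open>E_pi M_p is row i of M_p moved to row p, with all other rows zero; the summands
  therefore fill disjoint rows.\<close>

lemma msum_munit:
  assumes M: "\<And>p. p < n \<Longrightarrow> M p \<in> carrier_mat n n" and "i < n"
  shows "msum n (map (\<lambda>p. munit n p i * M p) [0..<n]) = mat n n (\<lambda>(r, s). M r $$ (i, s))"
proof (rule mat_eq_carrierI[of _ n n])
  fix r s assume rs: "r < n" "s < n"
  have "msum n (map (\<lambda>p. munit n p i * M p) [0..<n]) $$ (r, s)
      = (\<Sum>p\<leftarrow>[0..<n]. (munit n p i * M p) $$ (r, s))"
    by (rule msum_map_index) (use M rs in simp_all)
  also have "\<dots> = (\<Sum>p\<leftarrow>[0..<n]. if r = p then M p $$ (i, s) else 0)"
    by (rule arg_cong[of _ _ sum_list], rule map_cong)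
      (use M rs assms(2) in \<open>simp_all add: munit_mult_index(1) del: index_mult_mat\<close>)
  also have "\<dots> = M r $$ (i, s)" using rs by (simp add: interv_sum_list_conv_sum_set_nat)
  finally show "msum n (map (\<lambda>p. munit n p i * M p) [0..<n]) $$ (r, s) = mat n n (\<lambda>(r, s). M r $$ (i, s)) $$ (r, s)"
    using rs by simp
qed (use M in \<open>auto intro!: msum_carrier\<close>)

lemma comm_add_right:
  assumes "x \<in> carrier_mat n n" "a \<in> carrier_mat n n" "b \<in> carrier_mat n n"
  shows "comm x (a + b) = comm x a + comm x b"
proof -
  have [simp]: "x * a \<in> carrier_mat n n" "a * x \<in> carrier_mat n n" "x * b \<in> carrier_mat n n" "b * x \<in> carrier_mat n n"
    using assms by simp_all
  have "comm x (a + b) = (x * a + x * b) - (a * x + b * x)"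
    using assms by (simp add: comm_def mult_add_distrib_mat[of _ n n _ n] add_mult_distrib_mat[of _ n n _ _ n])
  also have "\<dots> = comm x a + comm x b"
    unfolding comm_def using assms
    by (intro mat_eq_carrierI[of _ n n]) (auto simp del: index_mult_mat(1))
  finally show ?thesis .
qed

lemma kron_vf_add:
  assumes "z \<in> carrier_mat n n" "z' \<in> carrier_mat n n"
    "\<And>k. c k \<in> carrier_mat n n" "\<And>k. c' k \<in> carrier_mat n n"
  shows "(kron z (1\<^sub>m 2) + vf c) + (kron z' (1\<^sub>m 2) + vf c')
    = kron (z + z') (1\<^sub>m 2) + vf (\<lambda>k. c k + c' k)"
proof -
  have "kron z (1\<^sub>m 2) \<in> carrier_mat (n*2) (n*2)" "kron z' (1\<^sub>m 2) \<in> carrier_mat (n*2) (n*2)"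
    "vf c \<in> carrier_mat (n*2) (n*2)" "vf c' \<in> carrier_mat (n*2) (n*2)"
    using assms by simp_all
  then have "(kron z (1\<^sub>m 2) + vf c) + (kron z' (1\<^sub>m 2) + vf c')
    = (kron z (1\<^sub>m 2) + kron z' (1\<^sub>m 2)) + (vf c + vf c')"
    by (intro mat_eq_carrierI[of _ "n*2" "n*2"]) auto
  then show ?thesis using assms by (simp add: kron_add_left[of _ n] vf_add[of _ n])
qed

section \<open>One-forms and two-forms through their coefficients\<close>

context fuzzy_sphere
begin

abbreviation "d \<equiv> Kdim N"
abbreviation A :: "complex mat set" where "A \<equiv> carrier_mat d d"
abbreviation "X \<equiv> Xop R N"

definition laplacian :: "complex mat \<Rightarrow> complex mat" where
  "laplacian b = sum3 (\<lambda>k. comm (X k) (comm (X k) b))"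

definition oneform_coef :: "(complex mat \<times> complex mat) list \<Rightarrow> ix \<Rightarrow> complex mat" where
  "oneform_coef ps q = msum d (map (\<lambda>(a, b). a * comm (X q) b) ps)"

definition laplacian_sum :: "(complex mat \<times> complex mat) list \<Rightarrow> complex mat" where
  "laplacian_sum ps = msum d (map (\<lambda>(a, b). a * laplacian b) ps)"

lemma X_carrier [simp]: "X k \<in> A"
  by (simp add: Xop_carrier)

lemma X_comm: "comm (X (nx m)) (X (nx (nx m))) = X m"
  by (simp add: Xop_comm)

lemma comm_X_zero: "comm (X k) (0\<^sub>m d d) = 0\<^sub>m d d"
  by (simp add: comm_def left_mult_zero_mat[of _ d d] right_mult_zero_mat[of _ d d])

lemma Hdim_eq: "Hdim N = d * 2"
  by (simp add: Hdim_def)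

lemma Dop_eq_vf: "Dop N R = vf X"
  by (simp add: Dop_def vf_def)

lemma laplacian_carrier [simp]: "b \<in> A \<Longrightarrow> laplacian b \<in> A"
  by (simp add: laplacian_def)

lemma oneform_coef_carrier [simp]: "set ps \<subseteq> A \<times> A \<Longrightarrow> oneform_coef ps q \<in> A"
  unfolding oneform_coef_def by (rule msum_carrier) auto

lemma laplacian_sum_carrier [simp]: "set ps \<subseteq> A \<times> A \<Longrightarrow> laplacian_sum ps \<in> A"
  unfolding laplacian_sum_def by (rule msum_carrier) auto

lemma oneform_coef_Nil: "oneform_coef [] q = 0\<^sub>m d d"
  and oneform_coef_Cons: "oneform_coef ((a, b) # ps) q = a * comm (X q) b + oneform_coef ps q"
  and laplacian_sum_Nil: "laplacian_sum [] = 0\<^sub>m d d"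
  and laplacian_sum_Cons: "laplacian_sum ((a, b) # ps) = a * laplacian b + laplacian_sum ps"
  by (simp_all add: oneform_coef_def laplacian_sum_def)

lemma oneform_eq_vf:
  assumes "set ps \<subseteq> A \<times> A"
  shows "msum (Hdim N) (map (\<lambda>(a, b). Lm a * comm (Dop N R) (Lm b)) ps) = vf (oneform_coef ps)"
  using assms
proof (induction ps)
  case Nil
  then show ?case
    using vf_zero[of d] by (simp add: Hdim_eq oneform_coef_Nil[abs_def])
next
  case (Cons p ps)
  obtain a b where p: "p = (a, b)" by fastforce
  with Cons have ab [simp]: "a \<in> A" "b \<in> A" and ps: "set ps \<subseteq> A \<times> A" by auto
  then have "Lm a * comm (Dop N R) (Lm b) + vf (oneform_coef ps) = vf (oneform_coef ((a, b) # ps))"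
    by (simp add: Dop_eq_vf vf_comm_Lm[of _ d] Lm_mult_vf[of _ d] vf_add[of _ d] oneform_coef_Cons[abs_def])
  with Cons ps p show ?case by simp
qed

text \<open>This is -sum_k [X_k, a][X_k, b] summed over the list and rewritten by
  \<open>comm_mult_eq\<close>; the overall sign comes from sigma_k^2 = -1.\<close>

definition twoform_scalar :: "(complex mat \<times> complex mat) list \<Rightarrow> complex mat" where
  "twoform_scalar ps = laplacian_sum ps - sum3 (\<lambda>k. comm (X k) (oneform_coef ps k))"

text \<open>The last summand is what the Jacobi identity leaves of the antisymmetrised double
  commutators, as [X_{m+1}, X_{m+2}] = X_m. It alone survives when the coefficients \<open>Y\<close>
  are multiples of the identity.\<close>

definition twoform_coef :: "(ix \<Rightarrow> complex mat) \<Rightarrow> ix \<Rightarrow> complex mat" where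
  "twoform_coef Y m = comm (X (nx (nx m))) (Y (nx m)) - comm (X (nx m)) (Y (nx (nx m))) + Y m"

text \<open>The Leibniz rule and the Jacobi identity express the exterior derivative through the coefficients of
  the one-form and a Laplacian term; the latter only contributes to the part \<open>A \<otimes> 1\<close>.\<close>
lemma twoform_eq:
  assumes "set ps \<subseteq> A \<times> A"
  shows "msum (Hdim N) (map (\<lambda>(a, b). comm (Dop N R) (Lm a) * comm (Dop N R) (Lm b)) ps)
    = kron (twoform_scalar ps) (1\<^sub>m 2) + vf (twoform_coef (oneform_coef ps))"
  using assms
proof (induction ps)
  case Nil
  have "twoform_coef (oneform_coef []) = (\<lambda>m. 0\<^sub>m d d)"
    by (auto simp: twoform_coef_def oneform_coef_Nil comm_X_zero)
  moreover have "twoform_scalar [] = 0\<^sub>m d d"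
    by (auto simp: twoform_scalar_def oneform_coef_Nil laplacian_sum_Nil comm_X_zero sum3_def)
  ultimately show ?case by (simp add: Hdim_eq vf_zero kron_zero)
next
  case (Cons p ps)
  obtain a b where p: "p = (a, b)" by fastforce
  with Cons have [simp]: "a \<in> A" "b \<in> A" and ps: "set ps \<subseteq> A \<times> A" by auto
  let ?z = "(-1) \<cdot>\<^sub>m sum3 (\<lambda>k. comm (X k) a * comm (X k) b)"
  let ?c = "\<lambda>m. comm (X (nx (nx m))) a * comm (X (nx m)) b - comm (X (nx m)) a * comm (X (nx (nx m))) b"
  have prod: "comm (Dop N R) (Lm a) * comm (Dop N R) (Lm b) = kron ?z (1\<^sub>m 2) + vf ?c"
    by (simp add: Dop_eq_vf vf_comm_Lm[of _ d] vf_mult_vf[of _ d])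
  have e: "comm (X i) (oneform_coef (p # ps) j) = comm (X i) (a * comm (X j) b) + comm (X i) (oneform_coef ps j)" for i j
    using ps by (simp add: p oneform_coef_Cons comm_add_right[of _ d])
  have l: "comm (X i) a * comm (X j) b = comm (X i) (a * comm (X j) b) - a * comm (X i) (comm (X j) b)" for i j
    by (rule comm_mult_eq[of _ d]) simp_all
  have z: "twoform_scalar (p # ps) = ?z + twoform_scalar ps"
  proof -
    \<comment> \<open>The rest is linear in these matrices, so it is checked entrywise with the
      commutators kept opaque.\<close>
    have id: "(sum3 l + S) - sum3 (\<lambda>k. e k + f k) = (-1) \<cdot>\<^sub>m sum3 (\<lambda>k. e k - l k) + (S - sum3 f)"
      if "\<And>k. l k \<in> A" "\<And>k. e k \<in> A" "\<And>k. f k \<in> A" "S \<in> A" for l e f S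
      using that[THEN carrier_matD(1)] that[THEN carrier_matD(2)] by (intro eq_matI) (simp_all add: sum3_def algebra_simps)
    have "a * laplacian b = sum3 (\<lambda>k. a * comm (X k) (comm (X k) b))"
      unfolding laplacian_def sum3_def by (simp add: mult_add_distrib_mat[of _ d d _ d])
    then have lap: "laplacian_sum (p # ps) = sum3 (\<lambda>k. a * comm (X k) (comm (X k) b)) + laplacian_sum ps"
      by (simp only: p laplacian_sum_Cons)
    show ?thesis
      unfolding twoform_scalar_def e l lap
      by (rule id[of "\<lambda>k. a * comm (X k) (comm (X k) b)" "\<lambda>k. comm (X k) (a * comm (X k) b)"
            "\<lambda>k. comm (X k) (oneform_coef ps k)" "laplacian_sum ps"]) (use ps in simp_all)
  qed
  have c: "twoform_coef (oneform_coef (p # ps)) m = ?c m + twoform_coef (oneform_coef ps) m" for m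
  proof -
    have id: "(e1 + f1) - (e2 + f2) + ((l2 - l1) + h) = ((e1 - l1) - (e2 - l2)) + (f1 - f2 + h)"
      if "l1 \<in> A" "e1 \<in> A" "f1 \<in> A" "l2 \<in> A" "e2 \<in> A" "f2 \<in> A" "h \<in> A" for l1 e1 f1 l2 e2 f2 h
      using that[THEN carrier_matD(1)] that[THEN carrier_matD(2)] by (intro eq_matI) simp_all
    \<comment> \<open>The Jacobi identity read backwards: [X_m, b] is expanded so as to cancel the
      double commutators that the Leibniz rule produces.\<close>
    have "a * comm (X m) b = a * comm (X (nx m)) (comm (X (nx (nx m))) b) - a * comm (X (nx (nx m))) (comm (X (nx m)) b)"
      using comm_jacobi[of "X (nx m)" d "X (nx (nx m))" b] X_comm[of m]
      by (simp add: mult_minus_distrib_mat[of _ d d _ d, symmetric])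
    then have Y: "oneform_coef (p # ps) m = a * comm (X (nx m)) (comm (X (nx (nx m))) b)
      - a * comm (X (nx (nx m))) (comm (X (nx m)) b) + oneform_coef ps m"
      by (simp only: p oneform_coef_Cons)
    show ?thesis
      unfolding twoform_coef_def e l Y by (rule id) (use ps in simp_all)
  qed
  have "?z \<in> A" "\<And>m. ?c m \<in> A" "twoform_scalar ps \<in> A" "\<And>m. twoform_coef (oneform_coef ps) m \<in> A"
    using ps by (auto simp: twoform_scalar_def twoform_coef_def)
  then have "kron (twoform_scalar (p # ps)) (1\<^sub>m 2) + vf (twoform_coef (oneform_coef (p # ps)))
    = kron ?z (1\<^sub>m 2) + vf ?c + (kron (twoform_scalar ps) (1\<^sub>m 2) + vf (twoform_coef (oneform_coef ps)))"
    unfolding z c[abs_def] by (intro kron_vf_add[symmetric])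
  then show ?case using Cons ps p prod by simp
qed

section \<open>Which pairs of one-form coefficients and Laplacian terms occur\<close>

definition realizes :: "(ix \<Rightarrow> complex mat) \<Rightarrow> complex mat \<Rightarrow> bool" where
  "realizes Y W \<longleftrightarrow> (\<exists>ps. set ps \<subseteq> A \<times> A \<and> oneform_coef ps = Y \<and> laplacian_sum ps = W)"

lemma realizes_carrier: "realizes Y W \<Longrightarrow> Y q \<in> A" "realizes Y W \<Longrightarrow> W \<in> A"
  by (auto simp: realizes_def)

lemma realizes_add:
  assumes "realizes Y W" "realizes Y' W'"
  shows "realizes (\<lambda>q. Y q + Y' q) (W + W')"
proof -
  obtain ps qs where "set ps \<subseteq> A \<times> A" "oneform_coef ps = Y" "laplacian_sum ps = W"
    "set qs \<subseteq> A \<times> A" "oneform_coef qs = Y'" "laplacian_sum qs = W'"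
    using assms by (auto simp: realizes_def)
  moreover have "oneform_coef (ps @ qs) q = oneform_coef ps q + oneform_coef qs q" for q
    unfolding oneform_coef_def map_append using calculation(1,4) by (intro msum_append) auto
  moreover have "laplacian_sum (ps @ qs) = laplacian_sum ps + laplacian_sum qs"
    unfolding laplacian_sum_def map_append using calculation(1,4) by (intro msum_append) auto
  ultimately show ?thesis
    unfolding realizes_def by (intro exI[of _ "ps @ qs"]) auto
qed

text \<open>Both data are left linear in the first components of the list, so multiplying those by
  \<open>y\<close> suffices.\<close>

lemma realizes_mult:
  assumes [simp]: "y \<in> A" and "realizes Y W"
  shows "realizes (\<lambda>q. y * Y q) (y * W)"
proof -
  obtain ps where ps: "set ps \<subseteq> A \<times> A" "oneform_coef ps = Y" "laplacian_sum ps = W"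
    using assms by (auto simp: realizes_def)
  let ?f = "map (\<lambda>(a, b). (y * a, b))"
  have "oneform_coef (?f ps) q = y * oneform_coef ps q \<and> laplacian_sum (?f ps) = y * laplacian_sum ps" for q
    using ps(1)
  proof (induction ps)
    case Nil
    then show ?case
      by (simp add: oneform_coef_Nil laplacian_sum_Nil right_mult_zero_mat[of _ d d])
  next
    case (Cons p ps)
    then show ?case
      by (cases p) (auto simp: oneform_coef_Cons laplacian_sum_Cons assoc_mult_mat[of _ d d _ d _ d]
          mult_add_distrib_mat[of _ d d _ d])
  qed
  with ps show ?thesis
    unfolding realizes_def by (intro exI[of _ "?f ps"]) auto
qed

lemma realizes_smult:
  assumes "realizes Y W"
  shows "realizes (\<lambda>q. c \<cdot>\<^sub>m Y q) (c \<cdot>\<^sub>m W)"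
  using realizes_mult[of "c \<cdot>\<^sub>m 1\<^sub>m d", OF _ assms] realizes_carrier[OF assms]
  by (simp add: mult_smult_assoc_mat[of _ d d _ d] left_mult_one_mat[of _ d d])

definition casimir :: "complex mat" where
  "casimir = sum3 (\<lambda>k. X k * X k)"

lemma casimir_carrier [simp]: "casimir \<in> A"
  by (simp add: casimir_def)

lemma comm_munit_index:
  assumes B: "B \<in> A" and "i < d" "j < d" "r < d" "s < d"
  shows "comm B (munit d j r) $$ (i, s) = B $$ (i, j) * (if r = s then 1 else 0) - (if i = j then 1 else 0) * B $$ (r, s)"
proof -
  have "comm B (munit d j r) $$ (i, s) = (B * munit d j r) $$ (i, s) - (munit d j r * B) $$ (i, s)"
    using assms by (simp add: comm_def munit_def del: index_mult_mat(1))
  then show ?thesis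
    using assms by (simp add: munit_mult_index del: index_mult_mat)
qed

text \<open>The expansion B^2 E - 2 B E B + E B^2 of the double commutator, read off at a matrix
  unit E.\<close>

lemma comm_comm_munit_index:
  assumes B [simp]: "B \<in> A" and ijrs: "i < d" "j < d" "r < d" "s < d"
  shows "comm B (comm B (munit d j r)) $$ (i, s)
    = (B * B) $$ (i, j) * (if r = s then 1 else 0) - 2 * B $$ (i, j) * B $$ (r, s) + (if i = j then 1 else 0) * (B * B) $$ (r, s)"
proof -
  let ?E = "munit d j r"
  have "comm B (comm B ?E) = (B * B * ?E - B * (?E * B)) - (B * (?E * B) - ?E * (B * B))"
    by (simp add: comm_def mult_minus_distrib_mat[of _ d d _ d] minus_mult_distrib_mat[of _ d d _ _ d]
        assoc_mult_mat[of _ d d _ d _ d])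
  moreover have "(B * (?E * B)) $$ (i, s) = B $$ (i, j) * B $$ (r, s)"
  proof -
    have "(B * (?E * B)) $$ (i, s) = (\<Sum>p<d. B $$ (i, p) * (if p = j then B $$ (r, s) else 0))"
      using ijrs by (simp add: mult_mat_index[of B d "?E * B"] munit_mult_index del: index_mult_mat)
    also have "\<dots> = (\<Sum>p<d. if p = j then B $$ (i, j) * B $$ (r, s) else 0)"
      by (rule sum.cong) auto
    finally show ?thesis using ijrs by simp
  qed
  moreover have "(B * B * ?E) $$ (i, s) = (B * B) $$ (i, j) * (if r = s then 1 else 0)"
    "(?E * (B * B)) $$ (i, s) = (if i = j then 1 else 0) * (B * B) $$ (r, s)"
    using ijrs munit_mult_index[of "B * B" d j r i s] by (simp_all del: index_mult_mat)
  ultimately show ?thesis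
    using ijrs by (simp add: carrier_matD[OF B] munit_def[of d j r] algebra_simps del: index_mult_mat(1))
qed

text \<open>The tensor \<open>\<Sum>\<^sub>p E\<^sub>p\<^sub>i \<otimes> E\<^sub>j\<^sub>p\<close> of matrix units sends \<open>B\<close> to \<open>\<Sum>\<^sub>p E\<^sub>p\<^sub>i B E\<^sub>j\<^sub>p = B\<^sub>i\<^sub>j 1\<close>.\<close>
lemma realizes_munit:
  assumes ij: "i < d" "j < d"
  shows "realizes
    (\<lambda>q. mat d d (\<lambda>(r, s). X q $$ (i, j) * (if r = s then 1 else 0) - (if i = j then 1 else 0) * X q $$ (r, s)))
    (mat d d (\<lambda>(r, s). casimir $$ (i, j) * (if r = s then 1 else 0)
      - 2 * sum3 (\<lambda>k. X k $$ (i, j) * X k $$ (r, s)) + (if i = j then 1 else 0) * casimir $$ (r, s)))"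
proof -
  let ?ps = "map (\<lambda>p. (munit d p i, munit d j p)) [0..<d]"
  note [simp] = carrier_matD[OF X_carrier]
  have "oneform_coef ?ps q = mat d d (\<lambda>(r, s). comm (X q) (munit d j r) $$ (i, s))" for q
    unfolding oneform_coef_def map_map comp_def case_prod_conv using ij by (intro msum_munit) auto
  then have 1: "oneform_coef ?ps = (\<lambda>q. mat d d (\<lambda>(r, s). X q $$ (i, j) * (if r = s then 1 else 0)
      - (if i = j then 1 else 0) * X q $$ (r, s)))"
    using ij by (auto intro!: eq_matI simp: comm_munit_index)
  have lap: "laplacian (munit d j r) $$ (i, s) = casimir $$ (i, j) * (if r = s then 1 else 0)
      - 2 * sum3 (\<lambda>k. X k $$ (i, j) * X k $$ (r, s)) + (if i = j then 1 else 0) * casimir $$ (r, s)"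
    if "r < d" "s < d" for r s
  proof -
    have "dim_row (comm (X k) B) = d" "dim_col (comm (X k) B) = d" if "B \<in> A" for B k
      by (simp_all only: carrier_matD[OF comm_carrier[OF X_carrier that]])
    then show ?thesis using that ij
      by (simp add: laplacian_def casimir_def sum3_def comm_comm_munit_index algebra_simps
        del: index_mult_mat(1))
  qed
  have lap_mat: "laplacian_sum ?ps = mat d d (\<lambda>(r, s). laplacian (munit d j r) $$ (i, s))"
    unfolding laplacian_sum_def map_map comp_def case_prod_conv using ij by (intro msum_munit) auto
  have 2: "laplacian_sum ?ps = mat d d (\<lambda>(r, s). casimir $$ (i, j) * (if r = s then 1 else 0)
      - 2 * sum3 (\<lambda>k. X k $$ (i, j) * X k $$ (r, s)) + (if i = j then 1 else 0) * casimir $$ (r, s))"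
    by (rule trans[OF lap_mat], intro eq_matI) (simp_all add: lap)
  show ?thesis
    unfolding realizes_def using 1 2 by (intro exI[of _ ?ps]) auto
qed

text \<open>The invariant form \<open>tr (X\<^sub>k X\<^sub>l)\<close> on the spin one half summand, occupying the rows 1 and 2, is
  nondegenerate; row 0 is the trivial summand.\<close>
lemma spin_half_block:
  obtains c where "c \<noteq> 0" "\<And>k. X k $$ (1, 1) + X k $$ (2, 2) = 0" "\<And>k. X k $$ (0, 0) = 0"
    "\<And>k l. X k $$ (1, 1) * X l $$ (1, 1) + X k $$ (1, 2) * X l $$ (2, 1)
       + X k $$ (2, 1) * X l $$ (1, 2) + X k $$ (2, 2) * X l $$ (2, 2) = (if k = l then c else 0)"
    "casimir $$ (0, 0) = 0" "casimir $$ (1, 1) + casimir $$ (2, 2) = 3 * c"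
proof -
  have d3: "3 \<le> d" using three_le_Kdim N_pos by simp
  have row: "X k $$ (i, j) = (if 1 \<le> i \<and> 1 \<le> j \<and> j < 3 then R 1 k $$ (i - 1, j - 1) else 0)"
    if "i < 3" "j < d" for i j k
    using Xop_index[of N i j k] that N_pos by simp
  have "su2_unitary_rep 2 (R 1)" "irreducible_rep 2 (R 1)"
    using irreps N_pos by (auto simp: su2_irreps_def numeral_2_eq_2)
  then obtain c where c: "c \<noteq> 0" "\<And>k. R 1 k $$ (0, 0) + R 1 k $$ (Suc 0, Suc 0) = 0"
    "\<And>k l. R 1 k $$ (0, 0) * R 1 l $$ (0, 0) + R 1 k $$ (0, Suc 0) * R 1 l $$ (Suc 0, 0)
       + R 1 k $$ (Suc 0, 0) * R 1 l $$ (0, Suc 0) + R 1 k $$ (Suc 0, Suc 0) * R 1 l $$ (Suc 0, Suc 0)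
     = (if k = l then c else 0)"
    by (rule spin_half_trace_form) blast
  have T: "X k $$ (1, 1) * X l $$ (1, 1) + X k $$ (1, 2) * X l $$ (2, 1)
       + X k $$ (2, 1) * X l $$ (1, 2) + X k $$ (2, 2) * X l $$ (2, 2) = (if k = l then c else 0)" for k l
    using c(3)[of k l] d3 by (simp add: row)
  \<comment> \<open>Rows 0, 1, 2 of X_k vanish outside columns 1 and 2, so only the block
    contributes to these diagonal entries.\<close>
  have sq: "(X k * X k) $$ (i, i) = X k $$ (i, 1) * X k $$ (1, i) + X k $$ (i, 2) * X k $$ (2, i)" if "i < 3" for k i
  proof -
    have "(X k * X k) $$ (i, i) = (\<Sum>p<d. X k $$ (i, p) * X k $$ (p, i))"
      using that d3 by (intro mult_mat_index) auto
    also have "\<dots> = (\<Sum>p\<in>{1, 2}. X k $$ (i, p) * X k $$ (p, i))"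
      using that d3 by (intro sum.mono_neutral_right) (auto simp: row)
    finally show ?thesis by simp
  qed
  have cas: "casimir $$ (i, i) = sum3 (\<lambda>k. (X k * X k) $$ (i, i))" if "i < 3" for i
    using that d3 by (simp add: casimir_def sum3_def carrier_matD[OF X_carrier] del: index_mult_mat(1))
  show thesis
  proof (rule that[OF c(1) _ _ T])
    show "X k $$ (1, 1) + X k $$ (2, 2) = 0" for k
      using c(2)[of k] d3 by (simp add: row)
    show "X k $$ (0, 0) = 0" for k
      using d3 by (simp add: row)
    show "casimir $$ (0, 0) = 0"
      using d3 by (simp add: cas sq sum3_def row del: index_mult_mat)
    \<comment> \<open>The trace of the Casimir over the block is the sum over the three k of the
      trace form at (k, k).\<close>
    show "casimir $$ (1, 1) + casimir $$ (2, 2) = 3 * c"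
    proof -
      have "casimir $$ (1, 1) + casimir $$ (2, 2) = sum3 (\<lambda>k. X k $$ (1, 1) * X k $$ (1, 1) + X k $$ (1, 2) * X k $$ (2, 1)
       + X k $$ (2, 1) * X k $$ (1, 2) + X k $$ (2, 2) * X k $$ (2, 2))"
        by (simp add: cas sq sum3_def algebra_simps del: index_mult_mat)
      then show ?thesis unfolding T sum3_def by simp
    qed
  qed
qed

text \<open>The two generators: the basis one-forms, and a presentation of the zero one-form whose
  Laplacian term is 1. By \<open>realizes_mult\<close> they yield all of \<open>Omega1\<close> and
  \<open>J2\<close>.\<close>

lemma realizes_scalar_ident:
  shows "\<exists>W. realizes (\<lambda>q. if q = k then 1\<^sub>m d else 0\<^sub>m d d) W"
    and "realizes (\<lambda>q. 0\<^sub>m d d) (1\<^sub>m d)"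
proof -
  have d3: "1 < d" "2 < d" "0 < d" using three_le_Kdim N_pos by (simp_all add: Suc_le_lessD numeral_3_eq_3 less_le_trans[of _ 3])
  obtain c where c: "c \<noteq> 0" "\<And>k. X k $$ (1, 1) + X k $$ (2, 2) = 0" "\<And>k. X k $$ (0, 0) = 0"
    "\<And>k l. X k $$ (1, 1) * X l $$ (1, 1) + X k $$ (1, 2) * X l $$ (2, 1)
       + X k $$ (2, 1) * X l $$ (1, 2) + X k $$ (2, 2) * X l $$ (2, 2) = (if k = l then c else 0)"
    "casimir $$ (0, 0) = 0" "casimir $$ (1, 1) + casimir $$ (2, 2) = 3 * c"
    using spin_half_block by blast
  note [simp] = carrier_matD[OF X_carrier] carrier_matD[OF casimir_carrier]
  define Y where "Y = (\<lambda>i j q. mat d d (\<lambda>(r, s). X q $$ (i, j) * (if r = s then 1 else 0) - (if i = j then 1 else 0) * X q $$ (r, s)))"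
  define W where "W = (\<lambda>i j. mat d d (\<lambda>(r, s). casimir $$ (i, j) * (if r = s then 1 else 0)
      - 2 * sum3 (\<lambda>k. X k $$ (i, j) * X k $$ (r, s)) + (if i = j then 1 else 0) * casimir $$ (r, s)))"
  have YW: "realizes (Y i j) (W i j)" if "i < d" "j < d" for i j
    using realizes_munit[OF that] unfolding Y_def W_def .
  have x22: "X q $$ (2, 2) = - X q $$ (1, 1)" for q using c(2)[of q] by (simp add: eq_neg_iff_add_eq_0 add.commute)
  \<comment> \<open>The unit tensor for (i, j) in the block gets weight X_k(j, i). The scalar parts
    then add up to the trace form of X_k and X_q on the block, while the contributions from i = j
    add up to the block trace of X_k, which is 0, times X_q.\<close>
  have "realizes (\<lambda>q. (1 / c) \<cdot>\<^sub>m ((X k $$ (1, 1) \<cdot>\<^sub>m Y 1 1 q + X k $$ (2, 1) \<cdot>\<^sub>m Y 1 2 q)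
      + (X k $$ (1, 2) \<cdot>\<^sub>m Y 2 1 q + X k $$ (2, 2) \<cdot>\<^sub>m Y 2 2 q)))
    ((1 / c) \<cdot>\<^sub>m ((X k $$ (1, 1) \<cdot>\<^sub>m W 1 1 + X k $$ (2, 1) \<cdot>\<^sub>m W 1 2)
      + (X k $$ (1, 2) \<cdot>\<^sub>m W 2 1 + X k $$ (2, 2) \<cdot>\<^sub>m W 2 2)))"
    using d3 by (intro realizes_smult realizes_add YW)
  moreover have "(1 / c) \<cdot>\<^sub>m ((X k $$ (1, 1) \<cdot>\<^sub>m Y 1 1 q + X k $$ (2, 1) \<cdot>\<^sub>m Y 1 2 q)
      + (X k $$ (1, 2) \<cdot>\<^sub>m Y 2 1 q + X k $$ (2, 2) \<cdot>\<^sub>m Y 2 2 q)) = (if q = k then 1\<^sub>m d else 0\<^sub>m d d)" for q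
  proof (rule mat_eq_carrierI[of _ d d])
    fix r s assume rs: "r < d" "s < d"
    let ?e = "if r = s then 1 else 0 :: complex"
    have "((1 / c) \<cdot>\<^sub>m ((X k $$ (1, 1) \<cdot>\<^sub>m Y 1 1 q + X k $$ (2, 1) \<cdot>\<^sub>m Y 1 2 q)
      + (X k $$ (1, 2) \<cdot>\<^sub>m Y 2 1 q + X k $$ (2, 2) \<cdot>\<^sub>m Y 2 2 q))) $$ (r, s)
      = (1 / c) * (((X k $$ (1, 1) * X q $$ (1, 1) + X k $$ (1, 2) * X q $$ (2, 1)
       + X k $$ (2, 1) * X q $$ (1, 2) + X k $$ (2, 2) * X q $$ (2, 2)) * ?e) - (X k $$ (1, 1) + X k $$ (2, 2)) * X q $$ (r, s))"
      using rs by (simp add: Y_def algebra_simps)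
    also have "\<dots> = (if q = k then 1\<^sub>m d else 0\<^sub>m d d) $$ (r, s)"
      unfolding c(2,4) using rs c(1) by auto
    finally show "((1 / c) \<cdot>\<^sub>m ((X k $$ (1, 1) \<cdot>\<^sub>m Y 1 1 q + X k $$ (2, 1) \<cdot>\<^sub>m Y 1 2 q)
      + (X k $$ (1, 2) \<cdot>\<^sub>m Y 2 1 q + X k $$ (2, 2) \<cdot>\<^sub>m Y 2 2 q))) $$ (r, s)
      = (if q = k then 1\<^sub>m d else 0\<^sub>m d d) $$ (r, s)" .
  qed (simp_all add: Y_def)
  ultimately show "\<exists>W. realizes (\<lambda>q. if q = k then 1\<^sub>m d else 0\<^sub>m d d) W" by auto

  \<comment> \<open>As X_q is traceless on the block, the units at 1 and 2 together give -2 X_q, and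
    the unit at 0 gives -X_q; hence the weight -2. The same weight cancels the full Casimir in W,
    the mixed terms vanish by tracelessness, and the block trace 3c of the Casimir remains.\<close>
  have "realizes (\<lambda>q. (1 / (3 * c)) \<cdot>\<^sub>m (Y 1 1 q + Y 2 2 q + (-2) \<cdot>\<^sub>m Y 0 0 q))
      ((1 / (3 * c)) \<cdot>\<^sub>m (W 1 1 + W 2 2 + (-2) \<cdot>\<^sub>m W 0 0))"
    using d3 by (intro realizes_smult realizes_add YW)
  moreover have "(1 / (3 * c)) \<cdot>\<^sub>m (Y 1 1 q + Y 2 2 q + (-2) \<cdot>\<^sub>m Y 0 0 q) = 0\<^sub>m d d" for q
    by (rule mat_eq_carrierI[of _ d d]) (simp_all add: Y_def x22 c(3) algebra_simps)
  moreover have "(1 / (3 * c)) \<cdot>\<^sub>m (W 1 1 + W 2 2 + (-2) \<cdot>\<^sub>m W 0 0) = 1\<^sub>m d"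
  proof (rule mat_eq_carrierI[of _ d d])
    fix r s assume rs: "r < d" "s < d"
    let ?e = "if r = s then 1 else 0 :: complex"
    have "((1 / (3 * c)) \<cdot>\<^sub>m (W 1 1 + W 2 2 + (-2) \<cdot>\<^sub>m W 0 0)) $$ (r, s)
      = (1 / (3 * c)) * ((casimir $$ (1, 1) + casimir $$ (2, 2)) * ?e)"
      using rs by (simp add: W_def x22 c(3) c(5) sum3_def algebra_simps)
    also have "\<dots> = 1\<^sub>m d $$ (r, s)"
      unfolding c(6) using rs c(1) by simp
    finally show "((1 / (3 * c)) \<cdot>\<^sub>m (W 1 1 + W 2 2 + (-2) \<cdot>\<^sub>m W 0 0)) $$ (r, s) = 1\<^sub>m d $$ (r, s)" .
  qed (simp_all add: W_def)
  ultimately show "realizes (\<lambda>q. 0\<^sub>m d d) (1\<^sub>m d)" by simp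
qed

lemma realizes_all:
  assumes Y: "\<And>k. Y k \<in> A"
  shows "\<exists>W. realizes Y W"
proof -
  have "\<exists>W. realizes (\<lambda>q. if q = k then Y k else 0\<^sub>m d d) W" for k
  proof -
    obtain W where "realizes (\<lambda>q. if q = k then 1\<^sub>m d else 0\<^sub>m d d) W"
      using realizes_scalar_ident by blast
    from realizes_mult[OF Y[of k] this] show ?thesis
      using Y[of k] by (auto simp: if_distrib[of "(*) (Y k)"] right_mult_one_mat[of _ d d]
          right_mult_zero_mat[of _ d d] cong: if_cong)
  qed
  then obtain W where W: "\<And>k. realizes (\<lambda>q. if q = k then Y k else 0\<^sub>m d d) (W k)" by metis
  have "realizes (\<lambda>q. (if q = i1 then Y i1 else 0\<^sub>m d d) + (if q = i2 then Y i2 else 0\<^sub>m d d)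
      + (if q = i3 then Y i3 else 0\<^sub>m d d)) (W i1 + W i2 + W i3)"
    by (intro realizes_add W)
  moreover have "(if q = i1 then Y i1 else 0\<^sub>m d d) + (if q = i2 then Y i2 else 0\<^sub>m d d)
      + (if q = i3 then Y i3 else 0\<^sub>m d d) = Y q" for q
    using Y by (cases q) (simp_all add: left_add_zero_mat[of _ d d] right_add_zero_mat[of _ d d])
  ultimately show ?thesis by auto
qed

section \<open>Determination of Omega^1 and J^2\<close>

lemma Omega1_eq: "Omega1 N R = {vf Y | Y. \<forall>k. Y k \<in> A}"
proof (intro equalityI subsetI)
  fix w assume "w \<in> Omega1 N R"
  then obtain ps where "set ps \<subseteq> A \<times> A" "w = vf (oneform_coef ps)"
    by (auto simp: Omega1_def Aalg_def oneform_eq_vf)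
  then show "w \<in> {vf Y | Y. \<forall>k. Y k \<in> A}" using oneform_coef_carrier by blast
next
  fix w assume "w \<in> {vf Y | Y. \<forall>k. Y k \<in> A}"
  then obtain Y where "w = vf Y" "\<And>k. Y k \<in> A" by blast
  then obtain W where "realizes Y W" using realizes_all by blast
  then obtain ps where "set ps \<subseteq> A \<times> A" "oneform_coef ps = Y" by (auto simp: realizes_def)
  with \<open>w = vf Y\<close> show "w \<in> Omega1 N R"
    unfolding Omega1_def Aalg_def by (intro CollectI exI[of _ ps]) (simp add: oneform_eq_vf)
qed

lemma twoform_coef_zero: "twoform_coef (\<lambda>q. 0\<^sub>m d d) = (\<lambda>m. 0\<^sub>m d d)"
  by (auto simp: twoform_coef_def comm_X_zero)

lemma kron_add_vf_zero: "z \<in> A \<Longrightarrow> kron z (1\<^sub>m 2) + vf (\<lambda>k. 0\<^sub>m d d) = kron z (1\<^sub>m 2)"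
  by (simp add: vf_zero right_add_zero_mat[of _ "d * 2" "d * 2"])

text \<open>When the one-form vanishes, so does the sigma part of the two-form, and the part in A
  (x) 1 reduces to the Laplacian term, which can be prescribed by multiplying the pair (0, 1) by
  \<open>z\<close>.\<close>

lemma J2_eq: "J2 N R = {kron z (1\<^sub>m 2) | z. z \<in> A}"
proof (intro equalityI subsetI)
  fix w assume "w \<in> J2 N R"
  then obtain ps where ps: "set ps \<subseteq> A \<times> A" "vf (oneform_coef ps) = 0\<^sub>m (d * 2) (d * 2)"
    "w = kron (twoform_scalar ps) (1\<^sub>m 2) + vf (twoform_coef (oneform_coef ps))"
    by (auto simp: J2_def Aalg_def oneform_eq_vf twoform_eq) (simp add: Hdim_eq)
  have "oneform_coef ps q = 0\<^sub>m d d" for q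
    using coef_vf[of "oneform_coef ps" N q] coef_vf[of "\<lambda>k. 0\<^sub>m d d" N q] ps by (simp add: vf_zero)
  then have "oneform_coef ps = (\<lambda>q. 0\<^sub>m d d)" by auto
  moreover have "twoform_scalar ps \<in> A" using ps by (simp add: twoform_scalar_def)
  ultimately show "w \<in> {kron z (1\<^sub>m 2) | z. z \<in> A}"
    using ps(3) by (auto simp: twoform_coef_zero kron_add_vf_zero)
next
  fix w assume "w \<in> {kron z (1\<^sub>m 2) | z. z \<in> A}"
  then obtain z where z: "z \<in> A" "w = kron z (1\<^sub>m 2)" by blast
  have "realizes (\<lambda>q. z * 0\<^sub>m d d) (z * 1\<^sub>m d)"
    by (rule realizes_mult[OF z(1) realizes_scalar_ident(2)])
  then obtain ps where ps: "set ps \<subseteq> A \<times> A" "oneform_coef ps = (\<lambda>q. 0\<^sub>m d d)" "laplacian_sum ps = z"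
    using z by (auto simp: realizes_def right_mult_one_mat[of _ d d] right_mult_zero_mat[of _ d d])
  have "twoform_scalar ps = z"
    using z by (simp add: twoform_scalar_def ps comm_X_zero sum3_def) (auto intro!: eq_matI)
  then have "msum (Hdim N) (map (\<lambda>(a, b). comm (Dop N R) (Lm a) * comm (Dop N R) (Lm b)) ps) = w"
    using twoform_eq[OF ps(1)] z by (simp add: ps(2) twoform_coef_zero kron_add_vf_zero)
  moreover have "msum (Hdim N) (map (\<lambda>(a, b). Lm a * comm (Dop N R) (Lm b)) ps) = 0\<^sub>m (Hdim N) (Hdim N)"
    using oneform_eq_vf[OF ps(1)] by (simp add: ps(2) vf_zero Hdim_eq)
  ultimately show "w \<in> J2 N R"
    using ps(1) unfolding J2_def Aalg_def by blast
qed

end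

lemma minus_mat_eq_zeroD:
  fixes B C :: "complex mat"
  assumes "B - C = 0\<^sub>m m n" "B \<in> carrier_mat m n" "C \<in> carrier_mat m n"
  shows "B = C"
proof (rule mat_eq_carrierI[OF assms(2,3)])
  fix i j assume "i < m" "j < n"
  then show "B $$ (i, j) = C $$ (i, j)"
    using arg_cong[OF assms(1), of "\<lambda>M. M $$ (i, j)"] assms(2,3) by simp
qed

section \<open>Wedge product and braiding in coefficients\<close>

context fuzzy_sphere
begin

lemma vf_inject:
  assumes "\<And>k. c k \<in> A" "\<And>k. c' k \<in> A" "vf c = vf c'"
  shows "c k = c' k"
  using assms coef_vf[of c N k] coef_vf[of c' N k] by simp

lemma inEE_vf: "(\<And>p q. G p q \<in> A) \<Longrightarrow> inEE N R (\<lambda>p. vf (G p))"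
  by (auto simp: inEE_def Omega1_eq)

lemma inEE_obtain:
  assumes "inEE N R \<xi>"
  obtains G where "\<xi> = (\<lambda>p. vf (G p))" "\<And>p q. G p q \<in> A"
proof -
  have "\<forall>p. \<exists>Y. \<xi> p = vf Y \<and> (\<forall>q. Y q \<in> A)"
    using assms by (auto simp: inEE_def Omega1_eq)
  then obtain G where "\<forall>p. \<xi> p = vf (G p) \<and> (\<forall>q. G p q \<in> A)" by metis
  with that[of G] show thesis by auto
qed

lemma wedge_rep_vf:
  assumes G: "\<And>p q. G p q \<in> A"
  shows "wedge_rep N (\<lambda>p. vf (G p)) = kron ((-1) \<cdot>\<^sub>m sum3 (\<lambda>k. G k k)) (1\<^sub>m 2)
    + vf (\<lambda>m. G (nx (nx m)) (nx m) - G (nx m) (nx (nx m)))"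
proof -
  have "ebas N k * vf (G k) = sum3 (\<lambda>l. kron (G k l) (sig k * sig l))" for k
    using G by (simp add: ebas_def kron_sig_mult_vf[of _ d] left_mult_one_mat[of _ d d])
  then show ?thesis
    using G by (simp add: wedge_rep_def sum3_kron_sig_mult[of _ d])
qed

text \<open>Turns an identity in Omega^2 into equations for the sigma coefficients, since
  \<open>J2\<close> absorbs nothing but A (x) 1.\<close>

lemma in_J2_imp_coef_zero:
  assumes "z \<in> A" "\<And>k. c k \<in> A" "kron z (1\<^sub>m 2) + vf c \<in> J2 N R"
  shows "c k = 0\<^sub>m d d"
proof -
  obtain z' where z': "z' \<in> A" "kron z (1\<^sub>m 2) + vf c = kron z' (1\<^sub>m 2)"
    using assms(3) by (auto simp: J2_eq)
  have "c k = coef N k (kron z (1\<^sub>m 2) + vf c)"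
    using assms by (simp add: coef_kron_vf)
  also have "\<dots> = coef N k (kron z' (1\<^sub>m 2) + vf (\<lambda>k. 0\<^sub>m d d))"
    using z' by (simp add: kron_add_vf_zero)
  also have "\<dots> = 0\<^sub>m d d"
    using z' by (simp add: coef_kron_vf)
  finally show ?thesis .
qed

text \<open>The trace part of the product lies in \<open>J2\<close>. The sigma_m part is the
  antisymmetrisation of G at (m+1, m+2), and the three values of m cover all off-diagonal
  pairs.\<close>

lemma ker_wedge_vf_iff:
  assumes G: "\<And>p q. G p q \<in> A"
  shows "(\<lambda>p. vf (G p)) \<in> ker_wedge N R \<longleftrightarrow> (\<forall>p q. G p q = G q p)"
proof
  assume "\<forall>p q. G p q = G q p"
  then have "wedge_rep N (\<lambda>p. vf (G p)) = kron ((-1) \<cdot>\<^sub>m sum3 (\<lambda>k. G k k)) (1\<^sub>m 2) + vf (\<lambda>m. 0\<^sub>m d d)"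
    using G by (simp add: wedge_rep_vf minus_r_inv_mat[of _ d d])
  also have "\<dots> = kron ((-1) \<cdot>\<^sub>m sum3 (\<lambda>k. G k k)) (1\<^sub>m 2)"
    using G by (intro kron_add_vf_zero) simp
  finally show "(\<lambda>p. vf (G p)) \<in> ker_wedge N R"
    using G inEE_vf[of G] by (auto simp: ker_wedge_def J2_eq)
next
  assume "(\<lambda>p. vf (G p)) \<in> ker_wedge N R"
  then have J: "kron ((-1) \<cdot>\<^sub>m sum3 (\<lambda>k. G k k)) (1\<^sub>m 2)
    + vf (\<lambda>m. G (nx (nx m)) (nx m) - G (nx m) (nx (nx m))) \<in> J2 N R"
    using G by (simp add: ker_wedge_def wedge_rep_vf)
  have sum: "(-1) \<cdot>\<^sub>m sum3 (\<lambda>k. G k k) \<in> A" using G by simp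
  have "G (nx (nx m)) (nx m) - G (nx m) (nx (nx m)) = 0\<^sub>m d d" for m
    using in_J2_imp_coef_zero[where c = "\<lambda>m. G (nx (nx m)) (nx m) - G (nx m) (nx (nx m))", OF sum _ J, of m] G by simp
  then have eq: "G (nx (nx m)) (nx m) = G (nx m) (nx (nx m))" for m
    by (rule minus_mat_eq_zeroD[OF _ G G])
  show "\<forall>p q. G p q = G q p"
  proof (intro allI)
    fix p q show "G p q = G q p"
      using eq[of i1] eq[of i2] eq[of i3] by (cases p; cases q) simp_all
  qed
qed

lemma Fanti_vf_iff:
  assumes G: "\<And>p q. G p q \<in> A"
  shows "(\<lambda>p. vf (G p)) \<in> Fanti N R \<longleftrightarrow> (\<forall>p q. G p q = - G q p)"
  using G inEE_vf[of G] by (auto simp: Fanti_def coef_vf)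

text \<open>Since \<open>J2\<close> is all of \<open>A \<otimes> 1\<close>, the kernel of the wedge product consists of the symmetric tensors,
  so the braiding is the flip.\<close>
lemma braid_vf:
  assumes G: "\<And>p q. G p q \<in> A"
  shows "braid N R (\<lambda>p. vf (G p)) = (\<lambda>p. vf (\<lambda>q. G q p))"
proof -
  let ?S = "\<lambda>p q. (1/2) \<cdot>\<^sub>m (G p q + G q p)"
  have S: "?S p q \<in> A" for p q using G by simp
  have Gd [simp]: "dim_row (G p q) = d" "dim_col (G p q) = d" for p q
    using G[of p q] by auto
  have "Psym N R (\<lambda>p. vf (G p)) = (\<lambda>p. vf (?S p))"
    unfolding Psym_def
  proof (rule the_equality)
    have "(\<lambda>p. vf (?S p)) \<in> ker_wedge N R"
      using G by (subst ker_wedge_vf_iff) (auto intro!: eq_matI)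
    moreover have "(\<lambda>p. vf (G p) - vf (?S p)) = (\<lambda>p. vf (\<lambda>q. G p q - ?S p q))"
      using G by (simp add: vf_minus[of _ d])
    moreover have "(\<lambda>p. vf (\<lambda>q. G p q - ?S p q)) \<in> Fanti N R"
      using G S by (subst Fanti_vf_iff) (auto intro!: eq_matI simp: field_simps)
    ultimately show "(\<lambda>p. vf (?S p)) \<in> ker_wedge N R \<and> (\<lambda>p. vf (G p) - vf (?S p)) \<in> Fanti N R"
      by simp
  next
    \<comment> \<open>Uniqueness: if P is symmetric and G - P antisymmetric, then adding the
      conditions at (p, q) and (q, p) leaves twice P equal to G plus its transpose.\<close>
    fix \<eta> assume \<eta>: "\<eta> \<in> ker_wedge N R \<and> (\<lambda>p. vf (G p) - \<eta> p) \<in> Fanti N R"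
    then obtain P where P: "\<eta> = (\<lambda>p. vf (P p))" "\<And>p q. P p q \<in> A"
      using inEE_obtain by (auto simp: ker_wedge_def)
    have Pd [simp]: "dim_row (P p q) = d" "dim_col (P p q) = d" for p q
      using P(2)[of p q] by auto
    have sym: "P p q = P q p" for p q
      using \<eta> P ker_wedge_vf_iff[of P] by simp
    have FP: "(\<lambda>p. vf (\<lambda>q. G p q - P p q)) \<in> Fanti N R"
      using \<eta> P G by (simp add: vf_minus[of _ d])
    have anti: "G p q - P p q = - (G q p - P q p)" for p q
    proof -
      have "G p q - P p q \<in> A" for p q using G P(2) by simp
      from iffD1[OF Fanti_vf_iff[of "\<lambda>p q. G p q - P p q", OF this]] FP show ?thesis by blast
    qed
    have "P p q = ?S p q" for p q
    proof (rule eq_matI)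
      fix i j assume "i < dim_row (?S p q)" "j < dim_col (?S p q)"
      then have ij: "i < d" "j < d" by simp_all
      have "(G p q - P p q) $$ (i, j) = (- (G q p - P q p)) $$ (i, j)"
        by (rule arg_cong[OF anti])
      then have "G p q $$ (i, j) - P p q $$ (i, j) = - (G q p $$ (i, j) - P p q $$ (i, j))"
        using ij by (simp add: sym[of q p])
      then have "G p q $$ (i, j) + G q p $$ (i, j) = 2 * P p q $$ (i, j)"
        by (simp add: algebra_simps)
      then show "P p q $$ (i, j) = ?S p q $$ (i, j)"
        using ij by simp
    qed simp_all
    then have "P = ?S" by (intro ext) simp
    then show "\<eta> = (\<lambda>p. vf (?S p))" using P(1) by simp
  qed
  moreover have "2 \<cdot>\<^sub>m vf (?S p) - vf (G p) = vf (\<lambda>q. G q p)" for p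
  proof -
    have "2 \<cdot>\<^sub>m vf (?S p) - vf (G p) = vf (\<lambda>q. 2 \<cdot>\<^sub>m ?S p q - G p q)"
      using G S by (simp add: vf_smult[of _ d] vf_minus[of _ d])
    also have "(\<lambda>q. 2 \<cdot>\<^sub>m ?S p q - G p q) = (\<lambda>q. G q p)"
      by (intro ext eq_matI) (simp_all add: field_simps)
    finally show ?thesis .
  qed
  ultimately show ?thesis by (simp add: braid_def)
qed

section \<open>Christoffel symbols of the central basis\<close>

definition delta :: "ix \<Rightarrow> ix \<Rightarrow> complex mat" where
  "delta k l = (if l = k then 1\<^sub>m d else 0\<^sub>m d d)"

lemma delta_carrier [simp]: "delta k l \<in> A"
  by (simp add: delta_def)

lemma ebas_eq_vf_delta: "ebas N k = vf (delta k)"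
  by (simp add: ebas_eq_vf delta_def[abs_def])

lemma coef_ebas: "coef N j (ebas N k) = delta k j"
  by (simp add: ebas_eq_vf_delta coef_vf)

lemma mult_delta: "a \<in> A \<Longrightarrow> a * delta k l = (if l = k then a else 0\<^sub>m d d)"
  by (simp add: delta_def right_mult_one_mat[of _ d d] right_mult_zero_mat[of _ d d])

text \<open>Metric compatibility is assumed for central one-forms; this allows testing it on the
  basis.\<close>

lemma ebas_in_centerE: "ebas N k \<in> centerE N R"
proof -
  have "ebas N k \<in> Omega1 N R" by (auto simp: Omega1_eq ebas_eq_vf_delta)
  moreover have "a * delta k l = delta k l * a" if "a \<in> A" for a l
    using that by (simp add: delta_def left_mult_one_mat[of _ d d] right_mult_one_mat[of _ d d]
        left_mult_zero_mat[of _ d d] right_mult_zero_mat[of _ d d])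
  then have "Lm a * ebas N k = ebas N k * Lm a" if "a \<in> A" for a
    using that by (simp add: ebas_eq_vf_delta Lm_mult_vf[of _ d] vf_mult_Lm[of _ d])
  ultimately show ?thesis by (simp add: centerE_def Aalg_def)
qed

text \<open>\<open>G k j l\<close> is the coefficient of e_j (x) e_l in nabla(e_k). For e_k and e_m
  the right side is d of a scalar, hence zero. On the left, the flip moves e_m next to e_j, where g
  contracts the two, leaving \<open>G k m\<close>; the second term contributes
  \<open>G m k\<close>.\<close>

lemma compatible_christoffel:
  assumes compat: "compatible N R nabla"
    and G: "\<And>k j l. G k j l \<in> A" and nabla: "\<And>k. nabla (ebas N k) = (\<lambda>j. vf (G k j))"
  shows "G k m l = - G m k l"
proof -
  have e: "g_id (\<lambda>j p. braid N R (tens N (nabla (ebas N k) j) (ebas N m)) p + Lm (coef N j (ebas N k)) * nabla (ebas N m) p)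
      = comm (Dop N R) (Lm (gmet N (tens N (ebas N k) (ebas N m))))"
    using compat ebas_in_centerE by (simp add: compatible_def)
  let ?z = "\<lambda>q. 0\<^sub>m d d :: complex mat"
  have zc: "comm (X q) (c \<cdot>\<^sub>m 1\<^sub>m d) = 0\<^sub>m d d" for q c
    by (simp add: comm_def mult_smult_distrib[of _ d d _ d] mult_smult_assoc_mat[of _ d d _ d]
      left_mult_one_mat[of _ d d] right_mult_one_mat[of _ d d] minus_r_inv_mat[of _ d d])
  have "tens N (ebas N k) (ebas N m) = (\<lambda>j. vf (\<lambda>l. delta k j * delta m l))"
    by (simp add: tens_def coef_vf ebas_eq_vf_delta Lm_mult_vf[of _ d])
  then have "gmet N (tens N (ebas N k) (ebas N m)) = sum3 (\<lambda>j. delta k j * delta m j)"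
    by (simp add: gmet_def coef_vf)
  also have "\<dots> = (if k = m then 1 else 0) \<cdot>\<^sub>m 1\<^sub>m d"
    by (cases k; cases m; intro eq_matI) (simp_all add: sum3_def mult_delta, simp_all add: delta_def)
  finally have rhs: "comm (Dop N R) (Lm (gmet N (tens N (ebas N k) (ebas N m)))) = vf ?z"
    by (simp add: Dop_eq_vf vf_comm_Lm[of _ d] zc)
  have "tens N (vf (G k j)) (ebas N m) = (\<lambda>p. vf (\<lambda>q. G k j p * delta m q))" for j
    using G by (simp add: tens_def coef_vf ebas_eq_vf_delta Lm_mult_vf[of _ d])
  then have b: "braid N R (tens N (nabla (ebas N k) j) (ebas N m)) = (\<lambda>p. vf (\<lambda>q. G k j q * delta m p))" for j
    using G by (simp add: nabla braid_vf)
  have "g_id (\<lambda>j p. braid N R (tens N (nabla (ebas N k) j) (ebas N m)) p + Lm (coef N j (ebas N k)) * nabla (ebas N m) p)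
     = sum3 (\<lambda>j. vf (\<lambda>q. G k j q * delta m j + delta k j * G m j q))"
    unfolding b using G by (simp add: g_id_def coef_ebas nabla Lm_mult_vf[of _ d] vf_add[of _ d])
  also have "\<dots> = vf (\<lambda>q. sum3 (\<lambda>j. G k j q * delta m j + delta k j * G m j q))"
    using G by (simp add: sum3_def vf_add[of _ d])
  also have "(\<lambda>q. sum3 (\<lambda>j. G k j q * delta m j + delta k j * G m j q)) = (\<lambda>q. G k m q + G m k q)"
  proof
    fix q
    have "delta k j * G m j q = (if j = k then G m k q else 0\<^sub>m d d)" for j
      using G by (simp add: delta_def left_mult_one_mat[of _ d d] left_mult_zero_mat[of _ d d])
    then show "sum3 (\<lambda>j. G k j q * delta m j + delta k j * G m j q) = G k m q + G m k q"
      using G[THEN carrier_matD(1)] G[THEN carrier_matD(2)]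
      by (cases k; cases m; intro eq_matI) (simp_all add: sum3_def mult_delta G)
  qed
  finally have "vf (\<lambda>q. G k m q + G m k q) = vf ?z" using e rhs by simp
  then have "G k m l + G m k l = 0\<^sub>m d d"
    using G vf_inject[of "\<lambda>q. G k m q + G m k q" ?z l] by simp
  then have "(G k m l + G m k l) $$ (i, j) = 0" if "i < d" "j < d" for i j
    using that by simp
  then show ?thesis
    using G[THEN carrier_matD(1)] G[THEN carrier_matD(2)] 
    by (intro eq_matI) (simp_all add: eq_neg_iff_add_eq_0)
qed

text \<open>Torsion is tested on a presentation of e_k obtained from \<open>realizes_all\<close>.
  Its Laplacian term is unknown but lies in A (x) 1 and vanishes modulo \<open>J2\<close>; the
  coefficients 1 and 0 commute with every X_p, so d e_k has again the coefficients of e_k.\<close>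

lemma torsionless_christoffel:
  assumes tors: "torsionless N R nabla"
    and G: "\<And>k j l. G k j l \<in> A" and nabla: "\<And>k. nabla (ebas N k) = (\<lambda>j. vf (G k j))"
  shows "G k (nx m) (nx (nx m)) - G k (nx (nx m)) (nx m) = delta k m"
proof -
  obtain W where "realizes (delta k) W" using realizes_all[of "delta k"] by auto
  then obtain ps where ps: "set ps \<subseteq> A \<times> A" "oneform_coef ps = delta k" by (auto simp: realizes_def)
  have [simp]: "twoform_scalar ps \<in> A" using ps by (auto simp: twoform_scalar_def)
  have comm_delta: "comm (X p) (delta k q) = 0\<^sub>m d d" for p q
    by (simp add: delta_def comm_X_zero) (simp add: comm_def left_mult_one_mat[of _ d d] right_mult_one_mat[of _ d d] minus_r_inv_mat[of _ d d])
  have tc: "twoform_coef (delta k) = delta k"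
    by (simp add: twoform_coef_def[abs_def] comm_delta minus_r_inv_mat[of _ d d] left_add_zero_mat[of _ d d])
  let ?c = "\<lambda>m. G k (nx (nx m)) (nx m) - G k (nx m) (nx (nx m))"
  have c: "?c m \<in> A" for m using G by simp
  have "wedge_rep N (nabla (ebas N k)) + (kron (twoform_scalar ps) (1\<^sub>m 2) + vf (delta k)) \<in> J2 N R"
    using tors ps oneform_eq_vf[of ps] twoform_eq[of ps] tc
    unfolding torsionless_def ebas_eq_vf_delta Aalg_def by metis
  then have J: "kron ((-1) \<cdot>\<^sub>m sum3 (\<lambda>j. G k j j) + twoform_scalar ps) (1\<^sub>m 2) + vf (\<lambda>m. ?c m + delta k m) \<in> J2 N R"
    using G c by (simp add: nabla wedge_rep_vf kron_vf_add[of _ d])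
  have z: "(-1) \<cdot>\<^sub>m sum3 (\<lambda>j. G k j j) + twoform_scalar ps \<in> A" using G by simp
  have "?c m + delta k m = 0\<^sub>m d d"
    using in_J2_imp_coef_zero[where c = "\<lambda>m. ?c m + delta k m" and k = m, OF z _ J] c by simp
  then have "(?c m + delta k m) $$ (i, j) = 0" if "i < d" "j < d" for i j
    using that by simp
  then show ?thesis
    using G[THEN carrier_matD(1)] G[THEN carrier_matD(2)] carrier_matD[OF delta_carrier]
    by (intro eq_matI) (simp_all add: algebra_simps)
qed

end

text \<open>Meant for a single matrix entry of the Christoffel symbols, with \<open>e\<close> the
  same entry of the identity. A repeated index forces 0. For distinct indices, antisymmetry reduces
  the symbols to three cyclic ones, whose pairwise sums are \<open>e\<close>, so each is
  e/2.\<close>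

lemma koszul:
  fixes g :: "ix \<Rightarrow> ix \<Rightarrow> ix \<Rightarrow> complex"
  assumes anti: "\<And>k j l. g k j l = - g j k l"
    and tors: "\<And>k m. g k (nx m) (nx (nx m)) - g k (nx (nx m)) (nx m) = (if m = k then e else 0)"
  shows "g k j l = - (1/2) * (lc j k l * e)"
proof -
  have diag: "g i i l = 0" for i l using anti[of i i l] by simp
  \<comment> \<open>For i and j distinct, the torsion condition at the third index exchanges the
    last two slots and leads to \<open>g i i j\<close>, which is 0.\<close>
  have zero: "g i j i = 0" for i j
    using diag[of i] tors[of i i1] tors[of i i2] tors[of i i3] by (cases i; cases j) auto
  have zero': "g i j j = 0" for i j
    using anti[of i j j] zero[of j i] by simp
  have a: "g i2 i1 i3 = - g i1 i2 i3" "g i3 i2 i1 = - g i2 i3 i1" "g i1 i3 i2 = - g i3 i1 i2"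
    by (rule anti)+
  have s: "g i1 i2 i3 + g i3 i1 i2 = e" "g i2 i3 i1 + g i1 i2 i3 = e" "g i3 i1 i2 + g i2 i3 i1 = e"
    using tors[of i1 i1] tors[of i2 i2] tors[of i3 i3] by (simp_all add: a)
  have half: "x = e / 2" if "x + y = e" "z + x = e" "y + z = e" for x y z
  proof -
    have "2 * x = (x + y) + (z + x) - (y + z)" by simp
    then show ?thesis unfolding that by (simp add: mult.commute)
  qed
  have h: "g i1 i2 i3 = e / 2" "g i2 i3 i1 = e / 2" "g i3 i1 i2 = e / 2"
    by (rule half[OF s], rule half[OF s(2,3,1)], rule half[OF s(3,1,2)])
  show ?thesis
    by (cases k; cases j; cases l) (simp_all add: diag zero zero' a h lc_def)
qed

theorem theorem8p6:
  fixes N :: nat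
    and R :: "nat \<Rightarrow> ix \<Rightarrow> complex mat"
    and nabla :: "complex mat \<Rightarrow> ix \<Rightarrow> complex mat"
  assumes "N \<ge> 1"
    and "su2_irreps N R"
    and "connection N R nabla"
    and "torsionless N R nabla"
    and "compatible N R nabla"
  shows "\<forall>j k. nabla (ebas N k) j = - (1/2) \<cdot>\<^sub>m sum3 (\<lambda>l. lc j k l \<cdot>\<^sub>m ebas N l)"
proof (intro allI)
  fix j k
  interpret fuzzy_sphere N R using assms by unfold_locales
  have "inEE N R (nabla (ebas N k))" for k
    using assms(3) ebas_in_centerE by (simp add: connection_def centerE_def)
  then have "\<exists>H. nabla (ebas N k) = (\<lambda>j. vf (H j)) \<and> (\<forall>j l. H j l \<in> carrier_mat (Kdim N) (Kdim N))" for k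
    by (metis inEE_obtain)
  then obtain G where nabla: "\<And>k. nabla (ebas N k) = (\<lambda>j. vf (G k j))"
    and G: "\<And>k j l. G k j l \<in> carrier_mat (Kdim N) (Kdim N)" by metis
  have anti: "G k j l = - G j k l" for k j l
    by (rule compatible_christoffel[OF assms(5) G nabla])
  have tors: "G k (nx m) (nx (nx m)) - G k (nx (nx m)) (nx m) = delta k m" for k m
    by (rule torsionless_christoffel[OF assms(4) G nabla])
  note [simp] = G[THEN carrier_matD(1)] G[THEN carrier_matD(2)]
  \<comment> \<open>The two conditions on the symbols are linear with scalar matrices as constants,
    so they decouple over the entries (r, s): on the diagonal \<open>koszul\<close> is applied with
    e = 1, off it with e = 0.\<close>
  have "G k j l = (- (1/2) * lc j k l) \<cdot>\<^sub>m 1\<^sub>m (Kdim N)" for k j l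
  proof (rule eq_matI)
    fix r s assume "r < dim_row ((- (1/2) * lc j k l) \<cdot>\<^sub>m 1\<^sub>m (Kdim N))"
      "s < dim_col ((- (1/2) * lc j k l) \<cdot>\<^sub>m 1\<^sub>m (Kdim N))"
    then have rs: "r < Kdim N" "s < Kdim N" by simp_all
    define e :: complex where "e = (if r = s then 1 else 0)"
    have "G k j l $$ (r, s) = - (1/2) * (lc j k l * e)"
    proof (rule koszul)
      show "G k j l $$ (r, s) = - G j k l $$ (r, s)" for k j l
        using arg_cong[OF anti[of k j l], of "\<lambda>M. M $$ (r, s)"] rs by simp
      show "G k (nx m) (nx (nx m)) $$ (r, s) - G k (nx (nx m)) (nx m) $$ (r, s) = (if m = k then e else 0)" for k m
        using arg_cong[OF tors[of k m], of "\<lambda>M. M $$ (r, s)"] rs by (simp add: delta_def e_def split: if_splits)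
    qed
    then show "G k j l $$ (r, s) = ((- (1/2) * lc j k l) \<cdot>\<^sub>m 1\<^sub>m (Kdim N)) $$ (r, s)"
      using rs by (simp add: e_def)
  qed simp_all
  then have "G k j = (\<lambda>l. (- (1/2) * lc j k l) \<cdot>\<^sub>m 1\<^sub>m (Kdim N))"
    by blast
  then have "nabla (ebas N k) j = vf (\<lambda>l. (- (1/2) * lc j k l) \<cdot>\<^sub>m 1\<^sub>m (Kdim N))"
    by (simp only: nabla)
  also have "\<dots> = - (1/2) \<cdot>\<^sub>m sum3 (\<lambda>l. lc j k l \<cdot>\<^sub>m ebas N l)"
  proof -
    have "kron ((- (1/2) * lc j k l) \<cdot>\<^sub>m 1\<^sub>m (Kdim N)) (sig l) = (- (1/2) * lc j k l) \<cdot>\<^sub>m ebas N l" for l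
      by (simp add: ebas_def kron_smult_left[of _ "Kdim N"])
    moreover have "dim_row (ebas N l) = Kdim N * 2" "dim_col (ebas N l) = Kdim N * 2" for l
      by (simp_all add: ebas_def carrier_matD[OF sig_carrier])
    ultimately show ?thesis
      unfolding vf_def by (intro eq_matI) (simp_all add: sum3_def algebra_simps)
  qed
  finally show "nabla (ebas N k) j = - (1/2) \<cdot>\<^sub>m sum3 (\<lambda>l. lc j k l \<cdot>\<^sub>m ebas N l)" .
qed

end
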